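(* Let $n\equiv 1 \pmod 4$ be a positive integer and let $a,c,d$ be indeterminates. Put \[h_q(a)=(1-aq^n)(a-q^n)\left\{\left(q^{2 } ; q^{4}\right)_{(n-1) / 4}^2(1-a^n)-n(aq^2,q^2/a;q^4)_{(n-1)/4}(1-a)a^{(n-1)/2}\right\}.\] Then, modulo $\Phi_{n}(q)^2(a-q^n)(1-aq^n)$, \begin{align*} &\sum_{k=0}^{(n-1)/4} [8 k+1]\frac{(q;q^4)_k^2(cq, dq, qa, q/a;q^4)_k}{(q^4;q^4)_k^2(q^4/c, q^4/d, q^4a, q^4/a;q^4)_k} ({cd})^{-k} q^{5 k} \\ &\quad\equiv \left\{q^{(1-n) / 4}[n]\frac{\left(q^{2 }; q^{4}\right)_{(n-1) / 4}}{\left(q^{4} ; q^{4}\right)_{(n-1) / 4}} + q^{(1-n)/4}[n]\frac{h_q(a)}{(1-a)^2(1-a^n)(q^2,q^4;q^4)_{(n-1)/4}}\right\} \sum_{k=0}^{(n-1)/4}\frac{(q, q^{3}/cd, aq, q/a;q^4)_k}{(q^{2},q^4,q^4/c,q^4/d;q^4)_k}q^{4k}. \end{align*}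
   Context: $(x;q)_m=(1-x)(1-xq)\cdots(1-xq^{m-1})$ (with $(x;q)_0=1$) is the $q$-shifted factorial and $(x_1,\dots,x_r;q)_m=(x_1;q)_m\cdots(x_r;q)_m$. The $q$-integer is $[m]=(1-q^m)/(1-q)$. $\Phi_n(q)$ denotes the $n$-th cyclotomic polynomial. A congruence between rational functions modulo a polynomial $P$ means that the numerator of the reduced difference is divisible by $P$ while its denominator is coprime to $P$. *)

theory Defs
  imports
    Complex_Main
    "HOL-Computational_Algebra.Computational_Algebra"
    "HOL-Computational_Algebra.Field_as_Ring"
    "HOL-Number_Theory.Cong"
begin

definition qpoch :: "'a::comm_ring_1 \<Rightarrow> 'a \<Rightarrow> nat \<Rightarrow> 'a" where
  "qpoch x q m = (\<Prod>i<m. 1 - x * q ^ i)"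

definition qpochs :: "'a::comm_ring_1 list \<Rightarrow> 'a \<Rightarrow> nat \<Rightarrow> 'a" where
  "qpochs xs q m = (\<Prod>x\<leftarrow>xs. qpoch x q m)"

definition qint :: "'a::field \<Rightarrow> nat \<Rightarrow> 'a" where
  "qint q m = (1 - q ^ m) / (1 - q)"

definition cyclotomic :: "nat \<Rightarrow> complex poly" where
  "cyclotomic n = (\<Prod>k\<in>{k\<in>{1..n}. coprime k n}. [:- cis (2 * pi * real k / real n), 1:])"

text \<open>
  The polynomial ring \<open>\<complex>[q][a][c][d]\<close>, with \<open>q\<close> the innermost and \<open>d\<close> the outermost
  indeterminate, and its fraction field \<open>\<complex>(q, a, c, d)\<close>.
\<close>

type_synonym poly_qacd = "complex poly poly poly poly"
type_synonym ratfun_qacd = "poly_qacd fract"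

definition embed_q :: "complex poly \<Rightarrow> poly_qacd" where
  "embed_q p = [:[:[:p:]:]:]"

definition var_q :: poly_qacd where "var_q = [:[:[:[:0, 1:]:]:]:]"
definition var_a :: poly_qacd where "var_a = [:[:[:0, 1:]:]:]"
definition var_c :: poly_qacd where "var_c = [:[:0, 1:]:]"
definition var_d :: poly_qacd where "var_d = [:0, 1:]"

text \<open>\<^const>\<open>quot_of_fract\<close> yields the numerator and denominator in lowest terms.\<close>

definition fract_cong ::
  "'a::{factorial_ring_gcd, semiring_gcd_mult_normalize} fract \<Rightarrow> 'a fract \<Rightarrow> 'a \<Rightarrow> bool" where
  "fract_cong x y P \<longleftrightarrow>
     P dvd fst (quot_of_fract (x - y)) \<and> coprime (snd (quot_of_fract (x - y))) P"

definition h_fun :: "nat \<Rightarrow> 'a::field \<Rightarrow> 'a \<Rightarrow> 'a" where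
  "h_fun n q a =
     (1 - a * q ^ n) * (a - q ^ n) *
     ((qpoch (q^2) (q^4) ((n - 1) div 4))^2 * (1 - a ^ n)
       - of_nat n * qpochs [a * q^2, q^2 / a] (q^4) ((n - 1) div 4)
           * (1 - a) * a ^ ((n - 1) div 2))"

end

theory Submission
  imports Defs
begin

text \<open>
  Write \<open>n = 4M + 1\<close>. The left-hand side is a very-well-poised sum in base \<open>q\<^sup>4\<close> with first parameter \<open>q\<close>
  and the five further parameters \<open>bq, cq, dq, aq, q/a\<close> at \<open>b = 1\<close>; call it \<open>F(b)\<close>. Modulo \<open>a - q\<^sup>n\<close> and
  modulo \<open>1 - aq\<^sup>n\<close> one of \<open>aq, q/a\<close> becomes \<open>q\<^sup>1\<^sup>-\<^sup>n = q\<^sup>-\<^sup>4\<^sup>M\<close>, so that Watson's transformation of a terminating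
  \<open>\<^sub>8\<phi>\<^sub>7\<close> applies, while \<open>h\<^sub>q(a)\<close> vanishes.

  For the factor \<open>\<Phi>\<^sub>n(q)\<^sup>2\<close> it suffices to work modulo \<open>(q - \<zeta>)\<^sup>2\<close> for each primitive \<open>n\<close>-th root of unity \<open>\<zeta>\<close>.
  At \<open>q = \<zeta>\<close> the summands of \<open>F(b)\<close> with indices \<open>k\<close> and \<open>M - k\<close> cancel for every \<open>b\<close>; hence \<open>F(b)\<close> is divisible
  by \<open>q - \<zeta>\<close> identically in \<open>b\<close>, and since \<open>q\<^sup>-\<^sup>n \<equiv> 1\<close> modulo \<open>q - \<zeta>\<close>, \<open>F(1) \<equiv> F(q\<^sup>-\<^sup>n)\<close> modulo \<open>(q - \<zeta>)\<^sup>2\<close>.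
  Watson's transformation evaluates \<open>F(q\<^sup>-\<^sup>n)\<close> as \<open>[n]\<close> times an expression that has to be compared
  with the right-hand side modulo \<open>q - \<zeta>\<close> only, and there the two prefactors agree because
  \<open>\<Prod>\<^sub>j\<^sub><\<^sub>n (1 - a\<zeta>\<^sup>j) = 1 - a\<^sup>n\<close>.

  Congruences are computed in the local ring of a point \<open>(q, a, c, d)\<close> of \<open>\<complex>\<^sup>4\<close> lying on the zero set
  of the modulus: there invertibility of a denominator is the non-vanishing of a complex number.
\<close>

section \<open>Watson's transformation\<close>

lemma qpoch_0 [simp]: "qpoch x q 0 = 1"
  by (simp add: qpoch_def)

lemma qpoch_Suc: "qpoch x q (Suc k) = qpoch x q k * (1 - x * q ^ k)"
  by (simp add: qpoch_def)

lemma qpoch_Suc_shift: "qpoch x q (Suc k) = (1 - x) * qpoch (x * q) q k"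
  by (simp add: qpoch_def prod.lessThan_Suc_shift mult.assoc power_commutes del: prod.lessThan_Suc)

lemma qpoch_add: "qpoch x q (j + k) = qpoch x q j * qpoch (x * q ^ j) q k"
  by (induction k) (simp_all add: qpoch_Suc power_add algebra_simps)

lemma qpochs_Nil [simp]: "qpochs [] q k = 1"
  by (simp add: qpochs_def)

lemma qpochs_Cons [simp]: "qpochs (x # xs) q k = qpoch x q k * qpochs xs q k"
  by (simp add: qpochs_def)

lemma qpoch_eq_0_iff:
  fixes x q :: "'a::idom"
  shows "qpoch x q k = 0 \<longleftrightarrow> (\<exists>i<k. x * q ^ i = 1)"
  by (auto simp: qpoch_def)

text \<open>Serves the induction step of both telescoping lemmas: their terms share a factor
  \<open>u\<close>, and once it is removed only a rational identity remains.\<close>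

lemma factor_out:
  fixes u :: "'a::comm_ring"
  assumes "k * A + (B - r * C) = k * D"
  shows "k * (u * A) + (u * B - r * (u * C)) = k * (u * D)"
proof -
  have "u * (k * A + (B - r * C)) = u * (k * D)" by (simp only: assms)
  then show ?thesis by (simp add: algebra_simps)
qed

section \<open>The q-Pfaff-Saalschuetz sum\<close>

text \<open>
  With \<open>z = q\<^sup>k\<close>, the combination \<open>t\<^sub>k\<^sub>+\<^sub>1 - r t\<^sub>k\<close> of consecutive summands, where \<open>r\<close> is the ratio of the claimed values,
  is a difference in the summation index, and the right-hand side below is the resulting Wilf-Zeilberger
  companion; it vanishes once \<open>J > k\<close>.
\<close>

lemma q_saalschuetz_telescoped:
  fixes a e q z B C :: "'a::field"
  assumes BC: "B * C = a * q * e" and q0: "q \<noteq> 0" and e0: "e \<noteq> 0" and z0: "z \<noteq> 0"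
    and qi: "\<And>i. q ^ Suc i \<noteq> 1" and Bi: "\<And>i. B * q ^ i \<noteq> 1" and Ci: "\<And>i. C * q ^ i \<noteq> 1"
    and Bz: "B * z \<noteq> 1" and Cz: "C * z \<noteq> 1"
  defines "r \<equiv> (e - C * z) * (e - B * z) / (e * (1 - B * z) * (1 - C * z))"
  shows "(\<Sum>j\<le>J. qpoch (1 / (z * q)) q j * qpoch (a * (z * q)) q j * qpoch e q j
            / (qpoch q q j * qpoch B q j * qpoch C q j) * q ^ j
          - r * (qpoch (1 / z) q j * qpoch (a * z) q j * qpoch e q j
            / (qpoch q q j * qpoch B q j * qpoch C q j) * q ^ j))
       = (1 - a * z\<^sup>2 * q) / ((1 - B * z) * (1 - C * z)) * (qpoch (1 / z) q J * qpoch (a * (z * q)) q J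
           * qpoch e q (Suc J) / (qpoch q q J * qpoch B q J * qpoch C q J))"
proof (induction J)
  case 0
  have nz: "(1 - B * z) \<noteq> 0" "(1 - C * z) \<noteq> 0" using Bz Cz by auto
  \<comment> \<open>In the numerator of 1 - r the terms linear in z cancel, and \<open>BC\<close>
    turns the quadratic one into a multiple of e.\<close>
  have "1 - r = (1 - a * z\<^sup>2 * q) * (1 - e) / ((1 - B * z) * (1 - C * z))"
    unfolding r_def using nz e0
    apply (simp add: divide_simps)
    using BC by algebra
  then show ?case by (simp add: qpoch_Suc)
next
  case (Suc J)
  define Z where "Z = q ^ J"
  \<comment> \<open>The common factor of the two summands and the two companions: numerators cut
    down to what all four contain, denominators taken at \<open>Suc J\<close>.\<close>
  define u where "u = qpoch (1 / z) q J * qpoch (a * (z * q)) q J * qpoch e q (Suc J)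
     / (qpoch q q (Suc J) * qpoch B q (Suc J) * qpoch C q (Suc J))"
  have nz: "(1 - B * z) \<noteq> 0" "(1 - C * z) \<noteq> 0" "1 - q * Z \<noteq> 0" "1 - B * Z \<noteq> 0" "1 - C * Z \<noteq> 0"
    using Bz Cz qi[of J] Bi[of J] Ci[of J] by (auto simp: Z_def)
  have pz: "qpoch q q J \<noteq> 0" "qpoch B q J \<noteq> 0" "qpoch C q J \<noteq> 0"
    using qi Bi Ci by (auto simp: qpoch_eq_0_iff)
  have t1: "qpoch (1 / (z * q)) q (Suc J) * qpoch (a * (z * q)) q (Suc J) * qpoch e q (Suc J)
            / (qpoch q q (Suc J) * qpoch B q (Suc J) * qpoch C q (Suc J)) * q ^ Suc J
     = u * ((1 - 1 / (z * q)) * (1 - a * (z * q) * Z) * (q * Z))"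
    using q0 by (simp add: u_def qpoch_Suc_shift[of "1 / (z*q)"] qpoch_Suc[of "a * (z*q)"] Z_def)
  have t2: "qpoch (1 / z) q (Suc J) * qpoch (a * z) q (Suc J) * qpoch e q (Suc J)
            / (qpoch q q (Suc J) * qpoch B q (Suc J) * qpoch C q (Suc J)) * q ^ Suc J
     = u * ((1 - Z / z) * (1 - a * z) * (q * Z))"
    by (simp add: u_def qpoch_Suc_shift[of "a * z"] qpoch_Suc[of "1 / z"] Z_def mult.assoc)
  have g0: "qpoch (1 / z) q J * qpoch (a * (z * q)) q J * qpoch e q (Suc J) / (qpoch q q J * qpoch B q J * qpoch C q J)
     = u * ((1 - q * Z) * (1 - B * Z) * (1 - C * Z))"
    using nz pz by (simp add: u_def qpoch_Suc Z_def mult.assoc)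
  have g1: "qpoch (1 / z) q (Suc J) * qpoch (a * (z * q)) q (Suc J) * qpoch e q (Suc (Suc J))
       / (qpoch q q (Suc J) * qpoch B q (Suc J) * qpoch C q (Suc J))
     = u * ((1 - Z / z) * (1 - a * (z * q) * Z) * (1 - e * (q * Z)))"
    by (simp add: u_def qpoch_Suc[of "1 / z"] qpoch_Suc[of "a * (z*q)"] qpoch_Suc[of e q "Suc J"] Z_def)
  have key: "(1 - a * z\<^sup>2 * q) / ((1 - B * z) * (1 - C * z)) * ((1 - q * Z) * (1 - B * Z) * (1 - C * Z))
     + ((1 - 1 / (z * q)) * (1 - a * (z * q) * Z) * (q * Z) - r * ((1 - Z / z) * (1 - a * z) * (q * Z)))
     = (1 - a * z\<^sup>2 * q) / ((1 - B * z) * (1 - C * z)) * ((1 - Z / z) * (1 - a * (z * q) * Z) * (1 - e * (q * Z)))"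
    unfolding r_def using nz(1,2) e0 q0 z0
    apply (simp add: divide_simps)
    using BC by algebra
  show ?case
    unfolding sum.atMost_Suc Suc.IH t1 t2 g0 g1 by (rule factor_out[OF key])
qed

lemma qpoch_inverse_power_eq_0:
  fixes q :: "'a::field"
  assumes "q \<noteq> 0"
  shows "qpoch (1 / q ^ k) q (Suc k) = 0"
  using assms by (simp add: qpoch_Suc)

text \<open>\<open>BC\<close> is the balancing condition of a terminating 3phi2. Induction on k: for
  z = q^k and J = k + 1 the companion in the telescoped identity is zero, so consecutive sums differ
  by the factor r.\<close>

lemma q_saalschuetz:
  fixes a e q B C :: "'a::field"
  assumes BC: "B * C = a * q * e" and q0: "q \<noteq> 0" and e0: "e \<noteq> 0"
    and qi: "\<And>i. q ^ Suc i \<noteq> 1" and Bi: "\<And>i. B * q ^ i \<noteq> 1" and Ci: "\<And>i. C * q ^ i \<noteq> 1"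
  shows "(\<Sum>j\<le>k. qpoch (1 / q ^ k) q j * qpoch (a * q ^ k) q j * qpoch e q j
            / (qpoch q q j * qpoch B q j * qpoch C q j) * q ^ j)
       = e ^ k * qpoch (C / e) q k * qpoch (B / e) q k / (qpoch B q k * qpoch C q k)"
proof (induction k)
  case 0
  then show ?case by simp
next
  case (Suc k)
  define t where "t = (\<lambda>z j. qpoch (1 / z) q j * qpoch (a * z) q j * qpoch e q j
            / (qpoch q q j * qpoch B q j * qpoch C q j) * q ^ j)"
  define z where "z = q ^ k"
  define r where "r = (e - C * z) * (e - B * z) / (e * (1 - B * z) * (1 - C * z))"
  have z0: "z \<noteq> 0" using q0 by (simp add: z_def)
  have "(\<Sum>j\<le>Suc k. t (z * q) j - r * t z j) = 0"
    using q_saalschuetz_telescoped[OF BC q0 e0 z0 qi Bi Ci, of "Suc k"] Bi[of k] Ci[of k]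
      qpoch_inverse_power_eq_0[OF q0, of k]
    by (simp add: t_def z_def r_def del: sum.atMost_Suc)
  \<comment> \<open>The sum for k may be extended by the index k + 1, so that both sums run over the
    same range.\<close>
  moreover have "t z (Suc k) = 0"
    using qpoch_inverse_power_eq_0[OF q0, of k] by (simp add: t_def z_def)
  ultimately have "(\<Sum>j\<le>Suc k. t (z * q) j) = r * (\<Sum>j\<le>k. t z j)"
    by (simp add: sum_subtractf sum_distrib_left algebra_simps)
  also have "(\<Sum>j\<le>k. t z j) = e ^ k * qpoch (C / e) q k * qpoch (B / e) q k / (qpoch B q k * qpoch C q k)"
    using Suc by (simp add: t_def z_def)
  also have "r * \<dots> = e ^ Suc k * qpoch (C / e) q (Suc k) * qpoch (B / e) q (Suc k)
      / (qpoch B q (Suc k) * qpoch C q (Suc k))"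
  proof -
    have nz: "1 - B * z \<noteq> 0" "1 - C * z \<noteq> 0"
      using Bi[of k] Ci[of k] by (auto simp: z_def)
    have "r = e * (1 - C / e * z) * (1 - B / e * z) / ((1 - B * z) * (1 - C * z))"
      using e0 nz by (simp add: r_def divide_simps)
    then show ?thesis by (simp add: qpoch_Suc z_def mult_ac)
  qed
  finally show ?case by (simp add: t_def z_def mult.commute)
qed

section \<open>The terminating very-well-poised 6phi5 sum\<close>

text \<open>Again a Wilf-Zeilberger pair. For f = q^(-N), passing to f/q raises N by one; y and x
  are the accompanying denominator parameter and argument, and r is the ratio of the closed forms
  for N + 1 and N.\<close>

lemma six_phi_five_telescoped:
  fixes a b c f q :: "'a::field"
  assumes q0: "q \<noteq> 0" and b0: "b \<noteq> 0" and c0: "c \<noteq> 0" and f0: "f \<noteq> 0"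
    and qi: "\<And>i. q ^ Suc i \<noteq> 1" and bi: "\<And>i. a * q ^ Suc i \<noteq> b" and ci: "\<And>i. a * q ^ Suc i \<noteq> c"
    and fi: "\<And>i. a * q ^ Suc i \<noteq> f" and bf: "a * q \<noteq> b * f" and cf: "a * q \<noteq> c * f"
  defines "y \<equiv> a * q / f" and "x \<equiv> a * q / (b * c * f)"
  defines "r \<equiv> (1 - y) * (1 - x) / ((1 - y / b) * (1 - y / c))"
  shows "(\<Sum>k\<le>K. (1 - a * q ^ (2 * k)) * (qpoch a q k * qpoch b q k * qpoch c q k * qpoch (f / q) q k)
            / (qpoch q q k * qpoch (a * q / b) q k * qpoch (a * q / c) q k * qpoch (y * q) q k) * (x * q) ^ k
          - r * ((1 - a * q ^ (2 * k)) * (qpoch a q k * qpoch b q k * qpoch c q k * qpoch f q k)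
            / (qpoch q q k * qpoch (a * q / b) q k * qpoch (a * q / c) q k * qpoch y q k) * x ^ k))
       = x / ((1 - y / b) * (1 - y / c)) * (qpoch a q (Suc K) * qpoch b q (Suc K) * qpoch c q (Suc K) * qpoch f q K
            / (qpoch q q K * qpoch (a * q / b) q K * qpoch (a * q / c) q K * qpoch (y * q) q K) * x ^ K)"
proof (induction K)
  case 0
  have nz: "(1 - y / b) \<noteq> 0" "(1 - y / c) \<noteq> 0" using bf cf b0 c0 f0 by (auto simp: y_def field_simps)
  have x: "x = y / (b * c)" by (simp add: x_def y_def)
  have "1 - r = x / ((1 - y / b) * (1 - y / c)) * ((1 - b) * (1 - c))"
    unfolding r_def using nz b0 c0 unfolding x
    by (simp add: divide_simps) (simp add: algebra_simps)
  then have "(1 - a) - r * (1 - a) = x / ((1 - y / b) * (1 - y / c)) * ((1 - a) * (1 - b) * (1 - c))"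
    using left_diff_distrib[of 1 r "1 - a"] by (simp only: mult_ac mult_1)
  then show ?case by (simp add: qpoch_Suc)
next
  case (Suc K)
  define Z where "Z = q * q ^ K"
  define u where "u = qpoch a q (Suc K) * qpoch b q (Suc K) * qpoch c q (Suc K) * qpoch f q K
     / (qpoch q q (Suc K) * qpoch (a * q / b) q (Suc K) * qpoch (a * q / c) q (Suc K) * qpoch (y * q) q (Suc K)) * x ^ K"
  have yi: "y * q ^ i \<noteq> 1" for i
    using fi[of i] f0 by (auto simp: y_def field_simps)
  have Bi: "a * q / b * q ^ i \<noteq> 1" and Ci: "a * q / c * q ^ i \<noteq> 1" for i
    using bi[of i] ci[of i] b0 c0 by (auto simp: field_simps)
  have yqi: "y * q * q ^ i \<noteq> 1" for i using yi[of "Suc i"] by (simp add: mult_ac)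
  have nz: "(1 - y / b) \<noteq> 0" "(1 - y / c) \<noteq> 0" "1 - y \<noteq> 0" "1 - Z \<noteq> 0" "1 - a * q / b * q ^ K \<noteq> 0"
    "1 - a * q / c * q ^ K \<noteq> 0" "1 - y * Z \<noteq> 0"
    using bf cf b0 c0 f0 yi[of 0] yi[of "Suc K"] qi[of K] Bi[of K] Ci[of K] by (auto simp: y_def field_simps Z_def)
  have pz: "qpoch q q m \<noteq> 0" "qpoch (a * q / b) q m \<noteq> 0" "qpoch (a * q / c) q m \<noteq> 0" "qpoch (y * q) q m \<noteq> 0" for m
    using qi Bi Ci yqi by (auto simp: qpoch_eq_0_iff)
  have Z2: "q ^ (2 * Suc K) = Z\<^sup>2" by (simp add: Z_def power_mult power2_eq_square mult_ac power_add mult_2)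
  have t1: "(1 - a * q ^ (2 * Suc K)) * (qpoch a q (Suc K) * qpoch b q (Suc K) * qpoch c q (Suc K) * qpoch (f / q) q (Suc K))
            / (qpoch q q (Suc K) * qpoch (a * q / b) q (Suc K) * qpoch (a * q / c) q (Suc K) * qpoch (y * q) q (Suc K)) * (x * q) ^ Suc K
     = u * ((1 - a * Z\<^sup>2) * x * ((1 - f / q) * Z))"
    unfolding Z2 qpoch_Suc_shift[of "f / q"] u_def using q0
    by (simp add: Z_def power_mult_distrib)
  \<comment> \<open>The two sums have denominators (yq)_k and (y)_k; this relation brings both to
    (yq)_k.\<close>
  have yK: "qpoch y q (Suc K) * (1 - y * Z) = (1 - y) * qpoch (y * q) q (Suc K)"
    using qpoch_Suc[of y q "Suc K"] qpoch_Suc_shift[of y q "Suc K"] by (simp add: Z_def)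
  then have yK': "qpoch y q (Suc K) = (1 - y) * qpoch (y * q) q (Suc K) / (1 - y * Z)"
    using nz by (simp add: field_simps)
  have t2: "(1 - a * q ^ (2 * Suc K)) * (qpoch a q (Suc K) * qpoch b q (Suc K) * qpoch c q (Suc K) * qpoch f q (Suc K))
            / (qpoch q q (Suc K) * qpoch (a * q / b) q (Suc K) * qpoch (a * q / c) q (Suc K) * qpoch y q (Suc K)) * x ^ Suc K
     = u * ((1 - a * Z\<^sup>2) * x * ((1 - f * Z / q) * (1 - y * Z) / (1 - y)))"
    unfolding Z2 qpoch_Suc[of f] u_def yK' using q0
    by (simp add: Z_def mult_ac)
  have g0: "qpoch a q (Suc K) * qpoch b q (Suc K) * qpoch c q (Suc K) * qpoch f q K
            / (qpoch q q K * qpoch (a * q / b) q K * qpoch (a * q / c) q K * qpoch (y * q) q K) * x ^ K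
      = u * ((1 - Z) * (1 - a * Z / b) * (1 - a * Z / c) * (1 - y * Z))"
  proof -
    have "qpoch q q (Suc K) = qpoch q q K * (1 - Z)" "qpoch (a * q / b) q (Suc K) = qpoch (a * q / b) q K * (1 - a * Z / b)"
      "qpoch (a * q / c) q (Suc K) = qpoch (a * q / c) q K * (1 - a * Z / c)"
      "qpoch (y * q) q (Suc K) = qpoch (y * q) q K * (1 - y * Z)"
      by (simp_all add: qpoch_Suc Z_def mult.assoc)
    with pz[of "Suc K"] pz[of K] show ?thesis unfolding u_def
      by (auto simp: mult_ac)
  qed
  have g1: "qpoch a q (Suc (Suc K)) * qpoch b q (Suc (Suc K)) * qpoch c q (Suc (Suc K)) * qpoch f q (Suc K)
            / (qpoch q q (Suc K) * qpoch (a * q / b) q (Suc K) * qpoch (a * q / c) q (Suc K) * qpoch (y * q) q (Suc K)) * x ^ Suc K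
      = u * (x * (1 - a * Z) * (1 - b * Z) * (1 - c * Z) * (1 - f * Z / q))"
    unfolding u_def qpoch_Suc[of _ q "Suc K"] qpoch_Suc[of f q K] using q0 by (simp add: Z_def)
  have yf: "y * f = a * q" using f0 by (simp add: y_def)
  have key: "x / ((1 - y / b) * (1 - y / c)) * ((1 - Z) * (1 - a * Z / b) * (1 - a * Z / c) * (1 - y * Z))
    + ((1 - a * Z\<^sup>2) * x * ((1 - f / q) * Z) - r * ((1 - a * Z\<^sup>2) * x * ((1 - f * Z / q) * (1 - y * Z) / (1 - y))))
    = x / ((1 - y / b) * (1 - y / c)) * (x * (1 - a * Z) * (1 - b * Z) * (1 - c * Z) * (1 - f * Z / q))"
  proof -
    have x: "x = y / (b * c)" by (simp add: x_def y_def)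
    have a: "a = y * f / q" using yf q0 by (simp add: field_simps)
    have r': "r * ((1 - a * Z\<^sup>2) * x * ((1 - f * Z / q) * (1 - y * Z) / (1 - y)))
       = x / ((1 - y / b) * (1 - y / c)) * ((1 - x) * (1 - a * Z\<^sup>2) * (1 - f * Z / q) * (1 - y * Z))"
      unfolding r_def using nz(3) by (simp add: mult_ac)
    have l: "(1 - a * Z\<^sup>2) * x * ((1 - f / q) * Z)
       = x / ((1 - y / b) * (1 - y / c)) * ((1 - a * Z\<^sup>2) * ((1 - f / q) * Z) * ((1 - y / b) * (1 - y / c)))"
      using nz(1,2) by auto
    \<comment> \<open>With the common prefactor removed, and x and a expressed through y, clearing
      denominators leaves a polynomial identity.\<close>
    have "(1 - Z) * (1 - a * Z / b) * (1 - a * Z / c) * (1 - y * Z)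
       + ((1 - a * Z\<^sup>2) * ((1 - f / q) * Z) * ((1 - y / b) * (1 - y / c))
       - (1 - x) * (1 - a * Z\<^sup>2) * (1 - f * Z / q) * (1 - y * Z))
       = x * (1 - a * Z) * (1 - b * Z) * (1 - c * Z) * (1 - f * Z / q)"
      unfolding x a using b0 c0 q0 by (simp add: divide_simps) (simp add: algebra_simps power2_eq_square)
    then show ?thesis unfolding r' l by (simp only: distrib_left[symmetric] right_diff_distrib[symmetric])
  qed
  show ?case
    unfolding sum.atMost_Suc Suc.IH t1 t2 g0 g1 by (rule factor_out[OF key])
qed

text \<open>Induction on N by the telescoped identity at f = q^(-N). The factor 1 - a is kept on the
  right, where Watson's transformation merges it with (a;q)_(2j).\<close>

lemma six_phi_five:
  fixes a b c q :: "'a::field"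
  assumes q0: "q \<noteq> 0" and b0: "b \<noteq> 0" and c0: "c \<noteq> 0"
    and qi: "\<And>i. q ^ Suc i \<noteq> 1" and ai: "\<And>i. a * q ^ Suc i \<noteq> 1"
    and bi: "\<And>i. a * q ^ Suc i \<noteq> b" and ci: "\<And>i. a * q ^ Suc i \<noteq> c"
  shows "(\<Sum>k\<le>N. (1 - a * q ^ (2 * k)) * (qpoch a q k * qpoch b q k * qpoch c q k * qpoch (1 / q ^ N) q k)
            / (qpoch q q k * qpoch (a * q / b) q k * qpoch (a * q / c) q k * qpoch (a * q * q ^ N) q k)
            * (a * q * q ^ N / (b * c)) ^ k)
       = (1 - a) * (qpoch (a * q) q N * qpoch (a * q / (b * c)) q N)
           / (qpoch (a * q / b) q N * qpoch (a * q / c) q N)"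
proof (induction N)
  case 0
  then show ?case by simp
next
  case (Suc N)
  define T where "T = (\<lambda>f y x k. (1 - a * q ^ (2 * k)) * (qpoch a q k * qpoch b q k * qpoch c q k * qpoch f q k)
            / (qpoch q q k * qpoch (a * q / b) q k * qpoch (a * q / c) q k * qpoch y q k) * x ^ k)"
  define f where "f = 1 / q ^ N"
  define y where "y = a * q * q ^ N"
  define x where "x = a * q * q ^ N / (b * c)"
  define r where "r = (1 - y) * (1 - x) / ((1 - y / b) * (1 - y / c))"
  have f0: "f \<noteq> 0" using q0 by (simp add: f_def)
  have fi: "a * q ^ Suc i \<noteq> f" for i
    using ai[of "i + N"] q0 by (simp add: f_def field_simps power_add)
  have bf: "a * q \<noteq> b * f" and cf: "a * q \<noteq> c * f"
    using bi[of N] ci[of N] q0 by (simp_all add: f_def field_simps)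
  have eqs: "a * q / f = y" "a * q / (b * c * f) = x" using q0 by (simp_all add: f_def y_def x_def)
  have Tz: "T f y x (Suc N) = 0"
    using qpoch_inverse_power_eq_0[OF q0, of N] by (simp add: T_def f_def)
  have "(\<Sum>k\<le>Suc N. T (f / q) (y * q) (x * q) k - r * T f y x k) = 0"
    using six_phi_five_telescoped[OF q0 b0 c0 f0 qi bi ci fi bf cf, of "Suc N", unfolded eqs]
      qpoch_inverse_power_eq_0[OF q0, of N]
    by (simp add: T_def r_def f_def del: sum.atMost_Suc power_Suc)
  then have "(\<Sum>k\<le>Suc N. T (f / q) (y * q) (x * q) k) = r * (\<Sum>k\<le>N. T f y x k)"
    using Tz by (simp add: sum_subtractf sum_distrib_left algebra_simps)
  also have "(\<Sum>k\<le>N. T f y x k) = (1 - a) * (qpoch (a * q) q N * qpoch (a * q / (b * c)) q N)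
           / (qpoch (a * q / b) q N * qpoch (a * q / c) q N)"
    unfolding Suc.IH[symmetric] by (simp add: T_def f_def y_def x_def)
  also have "r * \<dots> = (1 - a) * (qpoch (a * q) q (Suc N) * qpoch (a * q / (b * c)) q (Suc N))
           / (qpoch (a * q / b) q (Suc N) * qpoch (a * q / c) q (Suc N))"
    by (simp add: r_def y_def x_def qpoch_Suc mult_ac)
  finally show ?case by (simp add: T_def f_def y_def x_def mult_ac)
qed

section \<open>Watson's transformation from the two summation formulas\<close>

text \<open>Each factor is turned around by 1 - x q^i = -x q^i (1 - q^(-i)/x). The reversed product
  starts at x' = q^(1-j)/x.\<close>

lemma qpoch_reverse:
  fixes x x' q :: "'a::field"
  assumes "q \<noteq> 0" "x' * x * q ^ j = q"
  shows "qpoch x q j = (- x) ^ j * (\<Prod>i<j. q ^ i) * qpoch x' q j"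
  using assms(2)
proof (induction j arbitrary: x')
  case 0
  then show ?case by simp
next
  case (Suc j)
  have "x' * x * q ^ j = 1" using Suc.prems assms(1) by (simp add: mult.assoc)
  then have "1 - x * q ^ j = - x * q ^ j * (1 - x')" by (simp add: algebra_simps)
  moreover have "qpoch x q j = (- x) ^ j * (\<Prod>i<j. q ^ i) * qpoch (x' * q) q j"
    by (rule Suc.IH) (use Suc.prems in \<open>simp add: mult_ac\<close>)
  ultimately show ?case
    by (simp add: qpoch_Suc[of x] qpoch_Suc_shift[of x'])
qed

lemma sum_triangle_shift:
  fixes g :: "nat \<Rightarrow> nat \<Rightarrow> 'a::comm_monoid_add"
  shows "(\<Sum>k\<le>N. \<Sum>j\<le>k. g k j) = (\<Sum>j\<le>N. \<Sum>m\<le>N - j. g (j + m) j)"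
proof (induction N)
  case 0
  then show ?case by simp
next
  case (Suc N)
  have "(\<Sum>j\<le>N. \<Sum>m\<le>Suc N - j. g (j + m) j) = (\<Sum>j\<le>N. (\<Sum>m\<le>N - j. g (j + m) j) + g (Suc N) j)"
    by (intro sum.cong) (auto simp: Suc_diff_le)
  then show ?case using Suc by (simp add: sum.distrib add_ac)
qed

text \<open>The factors containing b and c are expanded by \<open>q_saalschuetz\<close> into a sum
  over j. After interchanging the sums and putting k = j + m, the sum over m is a 6phi5 with
  parameters shifted by j. \<open>dei\<close> keeps (de q^(-N)/a;q)_j away from zero.\<close>

lemma watson_transformation:
  fixes a b c d e q :: "'a::field"
  assumes q0: "q \<noteq> 0" and a0: "a \<noteq> 0" and a1: "a \<noteq> 1"
    and b0: "b \<noteq> 0" and c0: "c \<noteq> 0" and d0: "d \<noteq> 0" and e0: "e \<noteq> 0"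
    and qi: "\<And>i. q ^ Suc i \<noteq> 1" and ai: "\<And>i. a * q ^ Suc i \<noteq> 1"
    and bi: "\<And>i. a * q ^ Suc i \<noteq> b" and ci: "\<And>i. a * q ^ Suc i \<noteq> c"
    and di: "\<And>i. a * q ^ Suc i \<noteq> d" and ei: "\<And>i. a * q ^ Suc i \<noteq> e"
    and dei: "\<And>i. d * e * q ^ i \<noteq> a * q ^ N"
  shows "(\<Sum>k\<le>N. (1 - a * q ^ (2 * k)) / (1 - a)
             * (qpoch a q k * qpoch b q k * qpoch c q k * qpoch d q k * qpoch e q k * qpoch (1 / q ^ N) q k)
             / (qpoch q q k * qpoch (a * q / b) q k * qpoch (a * q / c) q k * qpoch (a * q / d) q k
                * qpoch (a * q / e) q k * qpoch (a * q * q ^ N) q k)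
             * ((a * q / (b * c)) * (a * q * q ^ N / (d * e))) ^ k)
       = qpoch (a * q) q N * qpoch (a * q / (d * e)) q N / (qpoch (a * q / d) q N * qpoch (a * q / e) q N)
         * (\<Sum>j\<le>N. qpoch (a * q / (b * c)) q j * qpoch d q j * qpoch e q j * qpoch (1 / q ^ N) q j
             / (qpoch q q j * qpoch (a * q / b) q j * qpoch (a * q / c) q j * qpoch (d * e / (a * q ^ N)) q j) * q ^ j)"
    (is "?L = ?R")
proof -
  define f where "f = 1 / q ^ N"
  define A where "A = a * q / (b * c)"
  define X where "X = a * q * q ^ N / (d * e)"
  define w where "w = (\<lambda>k. (1 - a * q ^ (2 * k)) * (qpoch a q k * qpoch d q k * qpoch e q k * qpoch f q k)
     / (qpoch q q k * qpoch (a * q / d) q k * qpoch (a * q / e) q k * qpoch (a * q * q ^ N) q k) * X ^ k)"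
  define s where "s = (\<lambda>k j. qpoch (1 / q ^ k) q j * qpoch (a * q ^ k) q j * qpoch A q j
            / (qpoch q q j * qpoch (a * q / b) q j * qpoch (a * q / c) q j) * q ^ j)"
  have Bi: "a * q / b * q ^ i \<noteq> 1" and Ci: "a * q / c * q ^ i \<noteq> 1"
    and Di: "a * q / d * q ^ i \<noteq> 1" and Ei: "a * q / e * q ^ i \<noteq> 1" for i
    using bi[of i] ci[of i] di[of i] ei[of i] b0 c0 d0 e0 by (auto simp: field_simps)
  have Fi: "a * q * q ^ N * q ^ i \<noteq> 1" for i
    using ai[of "N + i"] by (simp add: power_add mult_ac)
  have A0: "A \<noteq> 0" using a0 q0 b0 c0 by (simp add: A_def)
  \<comment> \<open>q-Saalschuetz with aq/b, aq/c and A in the roles of B, C and e, so that C/e = b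
    and B/e = c.\<close>
  have saal: "A ^ k * qpoch b q k * qpoch c q k / (qpoch (a * q / b) q k * qpoch (a * q / c) q k) = (\<Sum>j\<le>k. s k j)" for k
  proof -
    have "a * q / b * (a * q / c) = a * q * A" by (simp add: A_def)
    note * = q_saalschuetz[OF this q0 A0 qi Bi Ci, of k]
    have "a * q / c / A = b" "a * q / b / A = c" using a0 q0 b0 c0 by (auto simp: A_def)
    with * show ?thesis by (simp add: s_def)
  qed
  have "?L = (\<Sum>k\<le>N. w k * (\<Sum>j\<le>k. s k j)) / (1 - a)"
    unfolding saal[symmetric] sum_divide_distrib A_def[symmetric] X_def[symmetric] f_def[symmetric]
    by (rule sum.cong) (simp_all add: w_def power_mult_distrib mult_ac)
  also have "(\<Sum>k\<le>N. w k * (\<Sum>j\<le>k. s k j)) = (\<Sum>j\<le>N. \<Sum>m\<le>N - j. w (j + m) * s (j + m) j)"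
    by (simp add: sum_distrib_left sum_triangle_shift)
  also have "\<dots> = (\<Sum>j\<le>N. (1 - a) * (qpoch (a * q) q N * qpoch (a * q / (d * e)) q N
       / (qpoch (a * q / d) q N * qpoch (a * q / e) q N)
         * (qpoch A q j * qpoch d q j * qpoch e q j * qpoch f q j
             / (qpoch q q j * qpoch (a * q / b) q j * qpoch (a * q / c) q j * qpoch (d * e / (a * q ^ N)) q j) * q ^ j)))"
  proof (rule sum.cong[OF refl])
    fix j assume "j \<in> {..N}"
    then have jN: "j \<le> N" by simp
    define a' where "a' = a * q ^ (2 * j)"
    define d' where "d' = d * q ^ j"
    define e' where "e' = e * q ^ j"
    define \<tau> where "\<tau> = (\<Prod>i<j. q ^ i)"
    define Y where "Y = a' * q * q ^ (N - j) / (d' * e')"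
    \<comment> \<open>The part of the summand that does not depend on m.\<close>
    define cj where "cj = qpoch a q (2 * j) * (qpoch d q j * qpoch e q j * qpoch f q j)
      / (qpoch (a * q / d) q j * qpoch (a * q / e) q j * qpoch (a * q * q ^ N) q j)
      * ((- X / q ^ j) ^ j * \<tau>) * (qpoch A q j
            / (qpoch q q j * qpoch (a * q / b) q j * qpoch (a * q / c) q j) * q ^ j)"
    have qN: "q ^ N = q ^ j * q ^ (N - j)" using jN by (simp flip: power_add)
    have ff: "f * q ^ j = 1 / q ^ (N - j)" using q0 by (simp add: f_def qN)
    have q2: "q ^ (2 * j) = q ^ j * q ^ j" by (simp add: mult_2 power_add)
    have shifts: "a' * q / d' = a * q / d * q ^ j" "a' * q / e' = a * q / e * q ^ j"
      "a' * q * q ^ (N - j) = a * q * q ^ N * q ^ j" "Y = X / q ^ j" "a' * q / (d' * e') = a * q / (d * e)"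
      using q0 by (simp_all add: a'_def d'_def e'_def Y_def X_def q2 qN)
    have qm: "qpoch q q m \<noteq> 0" for m using qi by (auto simp: qpoch_eq_0_iff)
    have summand: "w (j + m) * s (j + m) j = cj * ((1 - a' * q ^ (2 * m))
        * (qpoch a' q m * qpoch d' q m * qpoch e' q m * qpoch (1 / q ^ (N - j)) q m)
            / (qpoch q q m * qpoch (a' * q / d') q m * qpoch (a' * q / e') q m * qpoch (a' * q * q ^ (N - j)) q m)
            * Y ^ m)" for m
    proof -
      \<comment> \<open>Reversal expresses (q^(-k);q)_j through (q;q)_k / (q;q)_m, k = j + m; then
        (q;q)_k cancels against the denominator of \<open>w\<close>.\<close>
      have 1: "qpoch (1 / q ^ (j + m)) q j = (- (1 / q ^ (j + m))) ^ j * \<tau> * (qpoch q q (j + m) / qpoch q q m)"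
      proof -
        have "qpoch (1 / q ^ (j + m)) q j = (- (1 / q ^ (j + m))) ^ j * \<tau> * qpoch (q * q ^ m) q j"
          unfolding \<tau>_def using q0 by (intro qpoch_reverse) (simp_all add: power_add)
        moreover have "qpoch q q (j + m) = qpoch q q m * qpoch (q * q ^ m) q j"
          by (subst add.commute) (rule qpoch_add)
        ultimately show ?thesis using qm[of m] by simp
      qed
      have "qpoch a q (j + m + j) = qpoch a q (2 * j + m)" by (simp add: mult_2 add_ac)
      then have 2: "qpoch a q (j + m) * qpoch (a * q ^ (j + m)) q j = qpoch a q (2 * j) * qpoch a' q m"
        unfolding qpoch_add a'_def by simp
      have 3: "X ^ (j + m) * (- (1 / q ^ (j + m))) ^ j = (- X / q ^ j) ^ j * Y ^ m"
      proof -
        have "(- (1 / q ^ (j + m))) ^ j = (- (1 / q ^ j)) ^ j * (1 / q ^ m) ^ j"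
          by (simp add: power_add flip: power_mult_distrib)
        also have "(1 / q ^ m) ^ j = (1 / q ^ j) ^ m"
          by (simp add: power_one_over mult.commute flip: power_mult)
        finally have m: "(- (1 / q ^ (j + m))) ^ j = (- (1 / q ^ j)) ^ j * (1 / q ^ j) ^ m" .
        have X: "- X / q ^ j = X * (- (1 / q ^ j))" by simp
        have Y: "Y = X * (1 / q ^ j)" by (simp add: shifts)
        show ?thesis unfolding m X Y power_mult_distrib power_add[of X] by (simp only: mult_ac)
      qed
      have 4: "a * q ^ (2 * (j + m)) = a' * q ^ (2 * m)" by (simp add: a'_def power_add algebra_simps)
      have 5: "qpoch d q (j + m) = qpoch d q j * qpoch d' q m" "qpoch e q (j + m) = qpoch e q j * qpoch e' q m"
        "qpoch f q (j + m) = qpoch f q j * qpoch (1 / q ^ (N - j)) q m"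
        "qpoch (a * q / d) q (j + m) = qpoch (a * q / d) q j * qpoch (a' * q / d') q m"
        "qpoch (a * q / e) q (j + m) = qpoch (a * q / e) q j * qpoch (a' * q / e') q m"
        "qpoch (a * q * q ^ N) q (j + m) = qpoch (a * q * q ^ N) q j * qpoch (a' * q * q ^ (N - j)) q m"
        unfolding qpoch_add shifts(1-3) ff by (simp_all add: d'_def e'_def)
      have "w (j + m) * s (j + m) j = (1 - a * q ^ (2 * (j + m))) * (qpoch a q (j + m) * qpoch (a * q ^ (j + m)) q j)
         * (qpoch d q (j + m) * qpoch e q (j + m) * qpoch f q (j + m))
         / (qpoch (a * q / d) q (j + m) * qpoch (a * q / e) q (j + m) * qpoch (a * q * q ^ N) q (j + m))
         * (X ^ (j + m) * (- (1 / q ^ (j + m))) ^ j) * \<tau> / qpoch q q m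
         * (qpoch A q j / (qpoch q q j * qpoch (a * q / b) q j * qpoch (a * q / c) q j) * q ^ j)"
        unfolding w_def s_def 1 using qm[of "j + m"] by (simp add: mult_ac)
      also have "\<dots> = cj * ((1 - a' * q ^ (2 * m))
        * (qpoch a' q m * qpoch d' q m * qpoch e' q m * qpoch (1 / q ^ (N - j)) q m)
            / (qpoch q q m * qpoch (a' * q / d') q m * qpoch (a' * q / e') q m * qpoch (a' * q * q ^ (N - j)) q m)
            * Y ^ m)"
        unfolding 2 3 4 5 cj_def by (simp add: mult_ac)
      finally show ?thesis .
    qed
    have d'0: "d' \<noteq> 0" "e' \<noteq> 0" using d0 e0 q0 by (auto simp: d'_def e'_def)
    have a'i: "a' * q ^ Suc i \<noteq> 1" for i
      using ai[of "2 * j + i"] by (simp add: a'_def power_add mult_ac)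
    have aq: "a' * q ^ Suc i = a * q ^ Suc (j + i) * q ^ j" for i
      unfolding a'_def q2 by (simp add: power_add mult_ac)
    have d'i: "a' * q ^ Suc i \<noteq> d'" for i
      using di[of "j + i"] q0 unfolding aq by (simp add: d'_def)
    have e'i: "a' * q ^ Suc i \<noteq> e'" for i
      using ei[of "j + i"] q0 unfolding aq by (simp add: e'_def)
    have "(\<Sum>m\<le>N - j. w (j + m) * s (j + m) j)
       = cj * ((1 - a') * (qpoch (a' * q) q (N - j) * qpoch (a' * q / (d' * e')) q (N - j))
           / (qpoch (a' * q / d') q (N - j) * qpoch (a' * q / e') q (N - j)))"
      unfolding summand Y_def sum_distrib_left[symmetric]
      by (simp only: six_phi_five[OF q0 d'0 qi a'i d'i e'i])
    also have "\<dots> = (1 - a) * (qpoch (a * q) q N * qpoch (a * q / (d * e)) q N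
       / (qpoch (a * q / d) q N * qpoch (a * q / e) q N)
         * (qpoch A q j * qpoch d q j * qpoch e q j * qpoch f q j
             / (qpoch q q j * qpoch (a * q / b) q j * qpoch (a * q / c) q j * qpoch (d * e / (a * q ^ N)) q j) * q ^ j))"
    proof -
      \<comment> \<open>The factors on the left are consecutive and make up (a;q)_(N+j+1), which is
        then split after the first and after the (N+1)-st factor.\<close>
      have 1: "qpoch a q (2 * j) * (1 - a') * qpoch (a' * q) q (N - j)
          = (1 - a) * qpoch (a * q) q N * qpoch (a * q * q ^ N) q j"
      proof -
        have "qpoch a q (2 * j) * (1 - a') = (1 - a) * qpoch (a * q) q (2 * j)"
          using qpoch_Suc[of a q "2 * j"] qpoch_Suc_shift[of a q "2 * j"] by (simp add: a'_def)
        moreover have "qpoch (a * q) q (2 * j) * qpoch (a' * q) q (N - j) = qpoch (a * q) q (N + j)"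
          using qpoch_add[of "a * q" q "2 * j" "N - j"] jN by (simp add: a'_def mult_ac add.commute mult_2)
        ultimately show ?thesis by (simp add: qpoch_add mult.assoc)
      qed
      have 2: "qpoch (a * q / d) q N = qpoch (a * q / d) q j * qpoch (a' * q / d') q (N - j)"
        "qpoch (a * q / e) q N = qpoch (a * q / e) q j * qpoch (a' * q / e') q (N - j)"
        using qpoch_add[of "a * q / d" q j "N - j"] qpoch_add[of "a * q / e" q j "N - j"] jN
        by (simp_all add: shifts)
      \<comment> \<open>Reversing the last j factors produces (de q^(-N)/a;q)_j together with
        exactly the power of X and the product \<tau> contained in \<open>cj\<close>.\<close>
      have 3: "qpoch (a * q / (d * e)) q N = qpoch (a' * q / (d' * e')) q (N - j)
          * ((- X / q ^ j) ^ j * \<tau> * qpoch (d * e / (a * q ^ N)) q j)"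
      proof -
        have Xj: "- (a * q / (d * e) * q ^ (N - j)) = - X / q ^ j" using q0 by (simp add: X_def qN)
        have "qpoch (a * q / (d * e) * q ^ (N - j)) q j
          = (- (a * q / (d * e) * q ^ (N - j))) ^ j * \<tau> * qpoch (d * e / (a * q ^ N)) q j"
          unfolding \<tau>_def using q0 a0 d0 e0 by (intro qpoch_reverse) (simp_all add: qN)
        then show ?thesis
          using qpoch_add[of "a * q / (d * e)" q "N - j" j] jN unfolding Xj by (simp add: shifts(5))
      qed
      have nz: "qpoch (d * e / (a * q ^ N)) q j \<noteq> 0" "qpoch (a * q * q ^ N) q j \<noteq> 0"
        using dei Fi a0 q0 by (auto simp: qpoch_eq_0_iff field_simps)
      define Z where "Z = qpoch A q j / (qpoch q q j * qpoch (a * q / b) q j * qpoch (a * q / c) q j) * q ^ j"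
      have "cj * ((1 - a') * (qpoch (a' * q) q (N - j) * qpoch (a' * q / (d' * e')) q (N - j))
           / (qpoch (a' * q / d') q (N - j) * qpoch (a' * q / e') q (N - j)))
        = (qpoch a q (2 * j) * (1 - a') * qpoch (a' * q) q (N - j)) * (qpoch d q j * qpoch e q j * qpoch f q j)
           * (qpoch (a' * q / (d' * e')) q (N - j) * ((- X / q ^ j) ^ j * \<tau>)) * Z
          / (qpoch (a * q / d) q N * qpoch (a * q / e) q N * qpoch (a * q * q ^ N) q j)"
        unfolding cj_def 2 Z_def by (simp add: mult_ac)
      also have "\<dots> = (1 - a) * qpoch (a * q) q N * (qpoch d q j * qpoch e q j * qpoch f q j)
           * (qpoch (a * q / (d * e)) q N / qpoch (d * e / (a * q ^ N)) q j) * Z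
          / (qpoch (a * q / d) q N * qpoch (a * q / e) q N)"
        unfolding 1 3 using nz by simp
      finally show ?thesis unfolding Z_def by (simp add: mult_ac)
    qed
    finally show "(\<Sum>m\<le>N - j. w (j + m) * s (j + m) j) = \<dots>" .
  qed
  finally show ?thesis
    unfolding sum_distrib_left[symmetric] A_def f_def using a1 by simp
qed

section \<open>The very-well-poised sum in base \<open>q\<^sup>4\<close>\<close>

text \<open>
  \<open>wp x q k\<close> is \<open>(xq;q\<^sup>4)\<^sub>k / (q\<^sup>4/x;q\<^sup>4)\<^sub>k\<close> with a factor \<open>x\<^sup>-\<^sup>k\<close> absorbed, which accounts for \<open>(cd)\<^sup>-\<^sup>k\<close> in the theorem.
\<close>

definition wp :: "'a::field \<Rightarrow> 'a \<Rightarrow> nat \<Rightarrow> 'a" where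
  "wp x q k = (\<Prod>i<k. (1 - x * q ^ (4 * i + 1)) / (x - q ^ (4 * i + 4)))"

text \<open>The prepended 1 stands for the first parameter q of the series, with its factor
  (q;q^4)_k / (q^4;q^4)_k; \<open>xs\<close> holds the remaining parameters divided by q.\<close>

definition vwp_term :: "'a::field \<Rightarrow> 'a list \<Rightarrow> nat \<Rightarrow> 'a" where
  "vwp_term q xs k = qint q (8 * k + 1) * (\<Prod>x\<leftarrow>1 # xs. wp x q k) * q ^ (5 * k)"

lemma wp_0 [simp]: "wp x q 0 = 1"
  by (simp add: wp_def)

lemma wp_Suc: "wp x q (Suc k) = wp x q k * ((1 - x * q ^ (4 * k + 1)) / (x - q ^ (4 * k + 4)))"
  by (simp add: wp_def)

lemma wp_conv_qpoch:
  assumes "x \<noteq> 0"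
  shows "wp x q k = qpoch (x * q) (q ^ 4) k / (x ^ k * qpoch (q ^ 4 / x) (q ^ 4) k)"
proof (induction k)
  case (Suc k)
  have 1: "x * q * (q ^ 4) ^ k = x * q ^ (4 * k + 1)" by (simp add: power_mult)
  have 2: "x - q ^ (4 * k + 4) = x * (1 - q ^ 4 / x * (q ^ 4) ^ k)"
    using assms by (simp add: power_mult power_add right_diff_distrib)
  show ?case unfolding wp_Suc Suc.IH qpoch_Suc 1 2 by (simp add: mult_ac)
qed simp

text \<open>Watson's transformation in base q^4 with first parameter q, the parameters cq, dq, sq,
  tq, and the terminating one q^(-4M) = q * q^(-n). The pair s, t determines the prefactor, while c,
  d occur in the sums only.\<close>

lemma watson_base_q4:
  fixes c d s t q :: "'a::field"
  assumes q0: "q \<noteq> 0" and qi: "\<And>i. 0 < i \<Longrightarrow> q ^ i \<noteq> 1" and n: "n = 4 * M + 1"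
    and nz: "c \<noteq> 0" "d \<noteq> 0" "s \<noteq> 0" "t \<noteq> 0"
    and ci: "\<And>i. c \<noteq> q ^ (4 * i + 4)" and di: "\<And>i. d \<noteq> q ^ (4 * i + 4)"
    and si: "\<And>i. s \<noteq> q ^ (4 * i + 4)" and ti: "\<And>i. t \<noteq> q ^ (4 * i + 4)"
    and sti: "\<And>i. s * t * q ^ (4 * i + 2) \<noteq> q ^ n"
  shows "(\<Sum>k\<le>M. vwp_term q [c, d, s, t, 1 / q ^ n] k)
     = qpoch (q ^ 5) (q ^ 4) M * qpoch (q ^ 3 / (s * t)) (q ^ 4) M
         / (qpoch (q ^ 4 / s) (q ^ 4) M * qpoch (q ^ 4 / t) (q ^ 4) M)
       * (\<Sum>k\<le>M. qpochs [q ^ 3 / (c * d), s * q, t * q, q / q ^ n] (q ^ 4) k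
            / qpochs [q ^ 4, q ^ 4 / c, q ^ 4 / d, s * t * q\<^sup>2 / q ^ n] (q ^ 4) k * q ^ (4 * k))"
proof -
  define Q where "Q = q ^ 4"
  have Qi: "Q ^ i = q ^ (4 * i)" for i by (simp add: Q_def power_mult)
  have q1: "q \<noteq> 1" using qi[of 1] by simp
  have qQ: "q * Q ^ Suc i = q ^ (4 * i + 4) * q" for i
    unfolding Qi by (simp add: algebra_simps)
  have "(\<Sum>k\<le>M. vwp_term q [c, d, s, t, 1 / q ^ n] k) =
     (\<Sum>k\<le>M. (1 - q * Q ^ (2 * k)) / (1 - q)
             * (qpoch q Q k * qpoch (c * q) Q k * qpoch (d * q) Q k * qpoch (s * q) Q k * qpoch (t * q) Q k * qpoch (1 / Q ^ M) Q k)
             / (qpoch Q Q k * qpoch (q * Q / (c * q)) Q k * qpoch (q * Q / (d * q)) Q k * qpoch (q * Q / (s * q)) Q k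
                * qpoch (q * Q / (t * q)) Q k * qpoch (q * Q * Q ^ M) Q k)
             * ((q * Q / (c * q * (d * q))) * (q * Q * Q ^ M / (s * q * (t * q)))) ^ k)"
  proof (rule sum.cong[OF refl])
    fix k
    have e: "q * Q / (x * q) = Q / x" for x using q0 by simp
    have g: "1 / q ^ n * q = 1 / Q ^ M" "Q / (1 / q ^ n) = q * Q * Q ^ M"
      using q0 by (simp_all add: Qi n)
    have qn: "q ^ n = q * Q ^ M" by (simp add: Qi n)
    have 1: "qint q (8 * k + 1) = (1 - q * Q ^ (2 * k)) / (1 - q)"
      by (simp add: qint_def Qi)
    have z: "(1 / q ^ n) \<noteq> 0" using q0 by simp
    \<comment> \<open>The argument of the series is q^5 over the product of the five list entries, a
      product that \<open>wp\<close> has absorbed.\<close>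
    have arg: "((q * Q / (c * q * (d * q))) * (q * Q * Q ^ M / (s * q * (t * q)))) ^ k
       = q ^ (5 * k) / (c ^ k * d ^ k * s ^ k * t ^ k * (1 / q ^ n) ^ k)"
    proof -
      have "(q * Q / (c * q * (d * q))) * (q * Q * Q ^ M / (s * q * (t * q))) = q ^ 5 / (c * d * s * t * (1 / q ^ n))"
        unfolding qn using q0 nz by (simp add: Q_def field_simps eval_nat_numeral)
      then show ?thesis by (simp add: power_divide power_mult power_mult_distrib)
    qed
    show "vwp_term q [c, d, s, t, 1 / q ^ n] k = (1 - q * Q ^ (2 * k)) / (1 - q)
             * (qpoch q Q k * qpoch (c * q) Q k * qpoch (d * q) Q k * qpoch (s * q) Q k * qpoch (t * q) Q k * qpoch (1 / Q ^ M) Q k)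
             / (qpoch Q Q k * qpoch (q * Q / (c * q)) Q k * qpoch (q * Q / (d * q)) Q k * qpoch (q * Q / (s * q)) Q k
                * qpoch (q * Q / (t * q)) Q k * qpoch (q * Q * Q ^ M) Q k)
             * ((q * Q / (c * q * (d * q))) * (q * Q * Q ^ M / (s * q * (t * q)))) ^ k"
      unfolding arg e vwp_term_def 1 list.map prod_list.Cons wp_conv_qpoch[OF nz(1)] wp_conv_qpoch[OF nz(2)]
        wp_conv_qpoch[OF nz(3)] wp_conv_qpoch[OF nz(4)] wp_conv_qpoch[OF z] wp_conv_qpoch[OF one_neq_zero]
        Q_def[symmetric] g
      by (simp add: mult_ac)
  qed
  also have "\<dots> = qpoch (q * Q) Q M * qpoch (q * Q / (s * q * (t * q))) Q M
       / (qpoch (q * Q / (s * q)) Q M * qpoch (q * Q / (t * q)) Q M)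
         * (\<Sum>j\<le>M. qpoch (q * Q / (c * q * (d * q))) Q j * qpoch (s * q) Q j * qpoch (t * q) Q j * qpoch (1 / Q ^ M) Q j
             / (qpoch Q Q j * qpoch (q * Q / (c * q)) Q j * qpoch (q * Q / (d * q)) Q j * qpoch (s * q * (t * q) / (q * Q ^ M)) Q j) * Q ^ j)"
  proof (rule watson_transformation)
    show "Q ^ Suc i \<noteq> 1" for i unfolding Qi using qi by simp
    show "q * Q ^ Suc i \<noteq> 1" for i unfolding Qi power_Suc[symmetric] using qi by blast
    show "q * Q ^ Suc i \<noteq> c * q" "q * Q ^ Suc i \<noteq> d * q" "q * Q ^ Suc i \<noteq> s * q" "q * Q ^ Suc i \<noteq> t * q" for i
      unfolding qQ using q0 ci[of i] di[of i] si[of i] ti[of i] by auto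
    show "s * q * (t * q) * Q ^ i \<noteq> q * Q ^ M" for i
      using sti[of i] by (simp add: Qi n power_add mult_ac power2_eq_square)
  qed (use q0 q1 nz in \<open>auto simp: Q_def\<close>)
  finally have main: "(\<Sum>k\<le>M. vwp_term q [c, d, s, t, 1 / q ^ n] k) = \<dots>" .
  have E1: "q * Q = q ^ 5" by (simp add: Q_def eval_nat_numeral)
  have E2: "q ^ 5 / (x * q * (y * q)) = q ^ 3 / (x * y)" "q ^ 5 / (x * q) = Q / x" for x y
    using q0 by (simp_all add: Q_def eval_nat_numeral)
  have E3: "1 / Q ^ M = q / q ^ n" "s * q * (t * q) / (q * Q ^ M) = s * t * q\<^sup>2 / q ^ n"
    using q0 by (simp_all add: Qi n power2_eq_square)
  have E4: "q ^ (4 * k) = Q ^ k" for k by (simp add: Qi)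
  show ?thesis unfolding main E1 E2 E3 E4 Q_def[symmetric] by (simp add: mult_ac)
qed

section \<open>Watson's transformation at the parameters of the theorem\<close>

text \<open>The source of the factor [n]: the products starting at q^5 and at q differ only in their
  end factors 1 - q^n and 1 - q.\<close>

lemma qpoch_q5:
  fixes q :: "'a::field"
  assumes "q \<noteq> 1" "n = 4 * M + 1"
  shows "qpoch (q ^ 5) (q ^ 4) M = qint q n * qpoch q (q ^ 4) M"
proof -
  have "q * q ^ 4 = q ^ 5" by (simp add: eval_nat_numeral)
  then have "(1 - q) * qpoch (q ^ 5) (q ^ 4) M = qpoch q (q ^ 4) M * (1 - q ^ n)"
    using qpoch_Suc[of q "q ^ 4" M] qpoch_Suc_shift[of q "q ^ 4" M] assms(2)
    by (simp flip: power_mult)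
  then show ?thesis using assms(1) by (simp add: qint_def field_simps)
qed

lemma power_eq_power_iff:
  fixes q :: "'a::field"
  assumes q0: "q \<noteq> 0" and qi: "\<And>i. 0 < i \<Longrightarrow> q ^ i \<noteq> 1"
  shows "q ^ i = q ^ j \<longleftrightarrow> i = j"
proof
  have le: "i = j" if "q ^ i = q ^ j" "i \<le> j" for i j
  proof (rule ccontr)
    assume "i \<noteq> j"
    with that have "i < j" by simp
    then have "q ^ j = q ^ i * q ^ (j - i)" by (simp flip: power_add)
    with that q0 qi[of "j - i"] \<open>i < j\<close> show False by simp
  qed
  show "i = j" if "q ^ i = q ^ j"
    using le[of i j] le[of j i] that by (cases "i \<le> j") auto
qed auto

text \<open>The case {a, 1/a} = {q^n, q^(-n)}, with s = 1 and t = q^n. Reversing two products in the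
  prefactor yields 1/q^M, which is q^((1-n)/4).\<close>

lemma watson_at_a:
  fixes c d q :: "'a::field"
  assumes q0: "q \<noteq> 0" and qi: "\<And>i. 0 < i \<Longrightarrow> q ^ i \<noteq> 1" and n: "n = 4 * M + 1"
    and nz: "c \<noteq> 0" "d \<noteq> 0"
    and ci: "\<And>i. c \<noteq> q ^ (4 * i + 4)" and di: "\<And>i. d \<noteq> q ^ (4 * i + 4)"
  shows "(\<Sum>k\<le>M. vwp_term q [c, d, 1, q ^ n, 1 / q ^ n] k)
     = 1 / q ^ M * qint q n * (qpoch (q\<^sup>2) (q ^ 4) M / qpoch (q ^ 4) (q ^ 4) M)
       * (\<Sum>k\<le>M. qpochs [q, q ^ 3 / (c * d), q ^ n * q, 1 / q ^ n * q] (q ^ 4) k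
            / qpochs [q\<^sup>2, q ^ 4, q ^ 4 / c, q ^ 4 / d] (q ^ 4) k * q ^ (4 * k))"
proof -
  have q1: "q \<noteq> 1" using qi[of 1] by simp
  have pow_inj: "q ^ i = q ^ j \<longleftrightarrow> i = j" for i j
    by (rule power_eq_power_iff[OF q0 qi])
  have W: "(\<Sum>k\<le>M. vwp_term q [c, d, 1, q ^ n, 1 / q ^ n] k)
     = qpoch (q ^ 5) (q ^ 4) M * qpoch (q ^ 3 / (1 * q ^ n)) (q ^ 4) M
         / (qpoch (q ^ 4 / 1) (q ^ 4) M * qpoch (q ^ 4 / q ^ n) (q ^ 4) M)
       * (\<Sum>k\<le>M. qpochs [q ^ 3 / (c * d), 1 * q, q ^ n * q, q / q ^ n] (q ^ 4) k
            / qpochs [q ^ 4, q ^ 4 / c, q ^ 4 / d, 1 * q ^ n * q\<^sup>2 / q ^ n] (q ^ 4) k * q ^ (4 * k))"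
  proof (rule watson_base_q4[OF q0 qi n nz _ _ ci di])
    show "1 \<noteq> q ^ (4 * i + 4)" for i using qi[of "4 * i + 4"] by auto
    have "n \<noteq> 4 * i + 4" for i unfolding n by presburger
    then show "q ^ n \<noteq> q ^ (4 * i + 4)" for i unfolding pow_inj by blast
    show "1 * q ^ n * q ^ (4 * i + 2) \<noteq> q ^ n" for i
      using qi[of "4 * i + 2"] q0 by simp
  qed (use q0 in auto)
  have q5: "q ^ 5 = q * q ^ 4" by (simp add: eval_nat_numeral)
  \<comment> \<open>(q^(3-n);q^4)_M and (q^(4-n);q^4)_M reverse to (q^2;q^4)_M and (q;q^4)_M; their
    unit factors agree up to q^M.\<close>
  define u where "u = (- (q ^ 3 / q ^ n)) ^ M * (\<Prod>i<M. (q ^ 4) ^ i)"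
  have qn: "q ^ n = q * (q ^ 4) ^ M" by (simp add: n power_mult)
  have "qpoch (q ^ 3 / q ^ n) (q ^ 4) M
      = (- (q ^ 3 / q ^ n)) ^ M * (\<Prod>i<M. (q ^ 4) ^ i) * qpoch (q\<^sup>2) (q ^ 4) M"
    by (rule qpoch_reverse) (use q0 in \<open>simp_all add: qn q5 field_simps\<close>)
  moreover have "qpoch (q ^ 4 / q ^ n) (q ^ 4) M
      = (- (q ^ 4 / q ^ n)) ^ M * (\<Prod>i<M. (q ^ 4) ^ i) * qpoch q (q ^ 4) M"
    by (rule qpoch_reverse) (use q0 in \<open>simp_all add: qn q5 field_simps\<close>)
  moreover have "(- (q ^ 4 / q ^ n)) ^ M = q ^ M * (- (q ^ 3 / q ^ n)) ^ M"
    by (simp add: eval_nat_numeral flip: power_mult_distrib)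
  moreover have "(\<Prod>i<M. (q ^ 4) ^ i) \<noteq> 0" "(- (q ^ 3 / q ^ n)) ^ M \<noteq> 0" using q0 by auto
  ultimately have "qpoch (q ^ 3 / q ^ n) (q ^ 4) M = u * qpoch (q\<^sup>2) (q ^ 4) M"
    "qpoch (q ^ 4 / q ^ n) (q ^ 4) M = u * (q ^ M * qpoch q (q ^ 4) M)" "u \<noteq> 0"
    by (simp_all only: u_def mult_ac mult_eq_0_iff not_False_eq_True de_Morgan_disj)
  then have R: "qpoch (q ^ 3 / q ^ n) (q ^ 4) M / qpoch (q ^ 4 / q ^ n) (q ^ 4) M
      = 1 / q ^ M * (qpoch (q\<^sup>2) (q ^ 4) M / qpoch q (q ^ 4) M)"
    by simp
  have "q * (q ^ 4) ^ i \<noteq> 1" for i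
    using qi[of "4 * i + 1"] by (simp add: power_mult)
  then have qM: "qpoch q (q ^ 4) M \<noteq> 0" by (auto simp: qpoch_eq_0_iff)
  have "qpoch (q ^ 5) (q ^ 4) M * qpoch (q ^ 3 / (1 * q ^ n)) (q ^ 4) M
         / (qpoch (q ^ 4 / 1) (q ^ 4) M * qpoch (q ^ 4 / q ^ n) (q ^ 4) M)
     = qint q n * qpoch q (q ^ 4) M / qpoch (q ^ 4) (q ^ 4) M
        * (qpoch (q ^ 3 / q ^ n) (q ^ 4) M / qpoch (q ^ 4 / q ^ n) (q ^ 4) M)"
    using qpoch_q5[OF q1 n] by simp
  also have "\<dots> = 1 / q ^ M * qint q n * (qpoch (q\<^sup>2) (q ^ 4) M / qpoch (q ^ 4) (q ^ 4) M)"
    unfolding R using qM by simp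
  finally show ?thesis unfolding W using q0 by (simp add: mult_ac)
qed

text \<open>The case b = q^(-n) with a free, so s = a, t = 1/a and st = 1. The explicit factor [n]
  later reduces a comparison modulo (q - \<zeta>)^2 to one modulo q - \<zeta>.\<close>

lemma watson_at_b:
  fixes a c d q :: "'a::field"
  assumes q0: "q \<noteq> 0" and qi: "\<And>i. 0 < i \<Longrightarrow> q ^ i \<noteq> 1" and n: "n = 4 * M + 1"
    and nz: "a \<noteq> 0" "c \<noteq> 0" "d \<noteq> 0"
    and ci: "\<And>i. c \<noteq> q ^ (4 * i + 4)" and di: "\<And>i. d \<noteq> q ^ (4 * i + 4)"
    and ai: "\<And>i. a \<noteq> q ^ (4 * i + 4)" "\<And>i. a * q ^ (4 * i + 4) \<noteq> 1"
  shows "(\<Sum>k\<le>M. vwp_term q [c, d, a, 1 / a, 1 / q ^ n] k)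
     = qint q n * (qpoch q (q ^ 4) M * qpoch (q ^ 3) (q ^ 4) M
         / (qpoch (q ^ 4 * a) (q ^ 4) M * qpoch (q ^ 4 / a) (q ^ 4) M)
       * (\<Sum>k\<le>M. qpochs [q / q ^ n, q ^ 3 / (c * d), a * q, q / a] (q ^ 4) k
            / qpochs [q\<^sup>2 / q ^ n, q ^ 4, q ^ 4 / c, q ^ 4 / d] (q ^ 4) k * q ^ (4 * k)))"
proof -
  have q1: "q \<noteq> 1" using qi[of 1] by simp
  have W: "(\<Sum>k\<le>M. vwp_term q [c, d, a, 1 / a, 1 / q ^ n] k)
     = qpoch (q ^ 5) (q ^ 4) M * qpoch (q ^ 3 / (a * (1 / a))) (q ^ 4) M
         / (qpoch (q ^ 4 / a) (q ^ 4) M * qpoch (q ^ 4 / (1 / a)) (q ^ 4) M)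
       * (\<Sum>k\<le>M. qpochs [q ^ 3 / (c * d), a * q, 1 / a * q, q / q ^ n] (q ^ 4) k
            / qpochs [q ^ 4, q ^ 4 / c, q ^ 4 / d, a * (1 / a) * q\<^sup>2 / q ^ n] (q ^ 4) k * q ^ (4 * k))"
  proof (rule watson_base_q4[OF q0 qi n nz(2,3) nz(1) _ ci di ai(1)])
    show "1 / a \<noteq> q ^ (4 * i + 4)" for i using ai(2)[of i] nz by (auto simp: field_simps)
    show "a * (1 / a) * q ^ (4 * i + 2) \<noteq> q ^ n" for i
    proof -
      have "4 * i + 2 \<noteq> n" unfolding n by presburger
      then show ?thesis using power_eq_power_iff[OF q0 qi, of "4 * i + 2" n] nz by simp
    qed
  qed (use nz in auto)
  show ?thesis unfolding W qpoch_q5[OF q1 n] using nz by (simp add: mult_ac)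
qed

section \<open>Identities at a primitive root of unity\<close>

text \<open>The logarithmic derivative of \<open>b \<mapsto> wp b q k\<close> at \<open>b = 1\<close>.\<close>

definition wp_log_deriv :: "'a::field \<Rightarrow> nat \<Rightarrow> 'a" where
  "wp_log_deriv q k = (\<Sum>i<k. (q ^ (8 * i + 5) - 1) / ((1 - q ^ (4 * i + 1)) * (1 - q ^ (4 * i + 4))))"

section \<open>Products over the powers of a primitive root of unity\<close>

text \<open>Stated over any field because it is used twice for the same root: as a complex number
  and as a constant rational function.\<close>

locale primitive_root =
  fixes z :: "'a::field" and n :: nat
  assumes n_pos: "0 < n" and root: "z ^ n = 1" and primitive: "\<And>i. z ^ i = 1 \<Longrightarrow> n dvd i"
begin

lemma z_nonzero: "z \<noteq> 0"
  using root n_pos by (metis zero_neq_one zero_power)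

lemma inj_powers: "inj_on (\<lambda>i. z ^ i) {..<n}"
proof -
  have le: "i = j" if "z ^ i = z ^ j" "i \<le> j" "j < n" for i j
  proof -
    have "z ^ j = z ^ i * z ^ (j - i)" using that(2) by (simp flip: power_add)
    with that z_nonzero have "z ^ (j - i) = 1" by simp
    with primitive have "n dvd j - i" by blast
    with that show ?thesis by (auto dest: dvd_imp_le)
  qed
  show ?thesis
  proof (rule inj_onI)
    fix i j assume "i \<in> {..<n}" "j \<in> {..<n}" "z ^ i = z ^ j"
    then show "i = j" using le[of i j] le[of j i] by (cases "i \<le> j") auto
  qed
qed

text \<open>Both sides have degree at most n and agree at n + 1 points, namely 0 and the n distinct
  powers of z.\<close>

lemma prod_linear_factors: "(\<Prod>i<n. [:1, - (z ^ i):]) = 1 - monom 1 n"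
proof -
  let ?p = "\<Prod>i<n. [:1, - (z ^ i):]" and ?A = "insert 0 ((\<lambda>i. z ^ i) ` {..<n})"
  show ?thesis
  proof (rule poly_eqI_degree)
    show "poly ?p x = poly (1 - monom 1 n) x" if "x \<in> ?A" for x
      using that
    proof
      assume "x = 0"
      then show ?thesis using n_pos by (simp add: poly_prod poly_monom)
    next
      assume "x \<in> (\<lambda>i. z ^ i) ` {..<n}"
      then obtain i where i: "i < n" "x = z ^ i" by auto
      have "\<exists>j<n. 1 - z ^ i * z ^ j = 0"
      proof (cases "i = 0")
        case True
        then show ?thesis using n_pos by (intro exI[of _ 0]) auto
      next
        case False
        then show ?thesis using i root by (intro exI[of _ "n - i"]) (auto simp flip: power_add)
      qed
      then have "poly ?p x = 0" using i by (auto simp: poly_prod)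
      moreover have "(z ^ i) ^ n = 1" using root by (metis mult.commute power_mult power_one)
      ultimately show ?thesis using i by (simp add: poly_monom)
    qed
    have "0 \<notin> (\<lambda>i. z ^ i) ` {..<n}" using z_nonzero by auto
    then have card: "card ?A = Suc n" using inj_powers by (simp add: card_image)
    have "degree ?p \<le> (\<Sum>i<n. degree [:1, - (z ^ i):])"
      using degree_prod_sum_le[of "{..<n}" "\<lambda>i. [:1, - (z ^ i):]"] by (simp only: finite_lessThan o_def)
    also have "\<dots> \<le> (\<Sum>i<n. 1)"
      by (rule sum_mono, rule order_trans[OF degree_pCons_le]) simp
    finally show "degree ?p < card ?A" unfolding card by simp
    have "degree (1 - monom (1::'a) n) \<le> n"
      by (rule degree_diff_le) (auto simp: degree_monom_le)
    then show "degree (1 - monom (1::'a) n) < card ?A" using card by simp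
  qed
qed

lemma prod_one_minus: "(\<Prod>i<n. 1 - x * z ^ i) = 1 - x ^ n"
  using arg_cong[OF prod_linear_factors, of "\<lambda>p. poly p x"] by (simp add: poly_prod poly_monom)

text \<open>Cancel the factor 1 - x from the factorization of 1 - x^n and put x = 1 in the remaining
  geometric sum.\<close>

lemma prod_one_minus_powers: "(\<Prod>i\<in>{1..<n}. 1 - z ^ i) = of_nat n"
proof -
  let ?g = "\<Prod>i\<in>{1..<n}. [:1, - (z ^ i):]" and ?s = "\<Sum>i<n. monom (1::'a) i"
  have "[:1, - 1:] * ?g = (\<Prod>i<n. [:1, - (z ^ i):])"
    using n_pos by (simp add: lessThan_atLeast0 prod.atLeast_Suc_lessThan)
  also have "\<dots> = 1 - monom 1 1 ^ n" by (simp add: prod_linear_factors monom_power)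
  also have "\<dots> = (1 - monom 1 1) * (\<Sum>i<n. monom 1 1 ^ i)" by (rule one_diff_power_eq)
  also have "\<dots> = [:1, - 1:] * ?s"
    by (simp add: monom_power monom_altdef one_pCons)
  finally have "?g = ?s" by (subst (asm) mult_left_cancel) auto
  then have "poly ?g 1 = poly ?s 1" by simp
  then show ?thesis by (simp add: poly_prod poly_sum poly_monom)
qed

end

section \<open>Reflection k -> M - k of the summands at a root of unity\<close>

locale primitive_root_4M1 = primitive_root +
  fixes M :: nat
  assumes n: "n = 4 * M + 1"
begin

lemma power_neq_1: "0 < i \<Longrightarrow> i < n \<Longrightarrow> z ^ i \<noteq> 1"
  using primitive[of i] by (auto dest: nat_dvd_not_less)

text \<open>The reflection i -> M - 1 - i pairs the exponents 4i + 1 with 4i + 4 and 4i + 2 with 4i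
  + 3 so that they add up to n.\<close>

lemma reflected_exponents:
  assumes "i < M"
  shows "z ^ (4 * (M - Suc i) + 1) * z ^ (4 * i + 4) = 1" "z ^ (4 * (M - Suc i) + 4) * z ^ (4 * i + 1) = 1"
    "z ^ (4 * (M - Suc i) + 3) * z ^ (4 * i + 2) = 1"
proof -
  have "4 * (M - Suc i) + 1 + (4 * i + 4) = n" "4 * (M - Suc i) + 4 + (4 * i + 1) = n"
    "4 * (M - Suc i) + 3 + (4 * i + 2) = n"
    using assms n by auto
  then show "z ^ (4 * (M - Suc i) + 1) * z ^ (4 * i + 4) = 1" "z ^ (4 * (M - Suc i) + 4) * z ^ (4 * i + 1) = 1"
    "z ^ (4 * (M - Suc i) + 3) * z ^ (4 * i + 2) = 1"
    using root by (simp_all only: power_add[symmetric])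
qed

text \<open>The numerator of each of the two factors cancels the denominator of the other up to a
  power of z, so x drops out.\<close>

lemma wp_factor_reflect:
  assumes "i < M" "\<And>i. i < M \<Longrightarrow> x \<noteq> z ^ (4 * i + 4)"
  shows "(1 - x * z ^ (4 * (M - Suc i) + 1)) / (x - z ^ (4 * (M - Suc i) + 4))
       * ((1 - x * z ^ (4 * i + 1)) / (x - z ^ (4 * i + 4))) * z ^ 3 = 1"
proof -
  define A B X Y where "A = z ^ (4 * (M - Suc i) + 1)" and "B = z ^ (4 * (M - Suc i) + 4)"
    and "X = z ^ (4 * i + 1)" and "Y = z ^ (4 * i + 4)"
  have AY: "A * Y = 1" and BX: "B * X = 1"
    using reflected_exponents[OF assms(1)] by (simp_all add: A_def B_def X_def Y_def)
  have XY: "X * z ^ 3 = Y" unfolding X_def Y_def power_add[symmetric] by (simp add: add_ac)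
  have nz: "x - B \<noteq> 0" "x - Y \<noteq> 0"
    using assms(2)[of i] assms(2)[of "M - Suc i"] assms(1) by (auto simp: B_def Y_def)
  have 1: "1 - x * A = - A * (x - Y)" "1 - x * X = - X * (x - B)"
    using AY BX by (simp_all add: algebra_simps)
  have "(1 - x * A) / (x - B) * ((1 - x * X) / (x - Y)) * z ^ 3 = A * (X * z ^ 3)"
    unfolding 1 using nz by simp
  then show ?thesis using AY XY by (simp add: A_def B_def X_def Y_def)
qed

text \<open>Removing the last k factors amounts to multiplying by the first k, since paired factors
  are reciprocal up to z^3.\<close>

lemma wp_reflect:
  assumes "\<And>i. i < M \<Longrightarrow> x \<noteq> z ^ (4 * i + 4)"
  shows "k \<le> M \<Longrightarrow> wp x z (M - k) = wp x z M * wp x z k * z ^ (3 * k)"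
proof (induction k)
  case (Suc k)
  define r where "r = (1 - x * z ^ (4 * k + 1)) / (x - z ^ (4 * k + 4))"
  define r' where "r' = (1 - x * z ^ (4 * (M - Suc k) + 1)) / (x - z ^ (4 * (M - Suc k) + 4))"
  have r: "r' * r * z ^ 3 = 1"
    using wp_factor_reflect[OF _ assms, of k] Suc.prems by (simp add: r_def r'_def)
  have "M - k = Suc (M - Suc k)" using Suc.prems by simp
  then have "wp x z (M - k) = wp x z (M - Suc k) * r'" by (simp add: wp_Suc r'_def)
  then have "wp x z (M - k) * (r * z ^ 3) = wp x z (M - Suc k) * (r' * r * z ^ 3)" by (simp add: mult_ac)
  then have "wp x z (M - Suc k) = wp x z (M - k) * (r * z ^ 3)" unfolding r by simp
  also have "\<dots> = wp x z M * (wp x z k * r) * (z ^ (3 * k) * z ^ 3)" using Suc by simp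
  also have "z ^ (3 * k) * z ^ 3 = z ^ (3 * Suc k)" by (simp add: add.commute flip: power_add)
  finally show ?case unfolding wp_Suc r_def .
qed simp

lemma one_minus_factor: "1 - x * A = - A * (x - Y)" if "A * Y = 1" for x A Y :: 'a
  using that by (simp add: algebra_simps)

text \<open>The reversed numerator cancels the whole denominator. The value is therefore the same
  for every x.\<close>

lemma wp_full:
  assumes "\<And>i. i < M \<Longrightarrow> x \<noteq> z ^ (4 * i + 4)"
  shows "wp x z M = (\<Prod>i<M. - (z ^ (4 * (M - Suc i) + 1)))"
proof -
  have "wp x z M = (\<Prod>i<M. 1 - x * z ^ (4 * i + 1)) / (\<Prod>i<M. x - z ^ (4 * i + 4))"
    by (simp add: wp_def prod_dividef)
  also have "(\<Prod>i<M. 1 - x * z ^ (4 * i + 1)) = (\<Prod>i<M. 1 - x * z ^ (4 * (M - Suc i) + 1))"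
    by (rule prod.nat_diff_reindex[symmetric])
  also have "\<dots> = (\<Prod>i<M. - (z ^ (4 * (M - Suc i) + 1)) * (x - z ^ (4 * i + 4)))"
  proof (rule prod.cong[OF refl])
    fix i assume "i \<in> {..<M}"
    then have "z ^ (4 * (M - Suc i) + 1) * z ^ (4 * i + 4) = 1" by (intro reflected_exponents) simp
    then show "1 - x * z ^ (4 * (M - Suc i) + 1) = - (z ^ (4 * (M - Suc i) + 1)) * (x - z ^ (4 * i + 4))"
      by (rule one_minus_factor)
  qed
  also have "\<dots> = (\<Prod>i<M. - (z ^ (4 * (M - Suc i) + 1))) * (\<Prod>i<M. x - z ^ (4 * i + 4))"
    by (rule prod.distrib)
  finally show ?thesis using assms by simp
qed

text \<open>Five entries and the prepended 1 give six factors \<open>wp\<close>, each contributing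
  the same \<kappa> z^(3k). Together with q^(5k) this leaves z^(8k+1), which turns [8(M-k)+1] into
  -[8k+1].\<close>

lemma vwp_term_reflect:
  assumes len: "length xs = 5" and x: "\<And>x i. x \<in> set xs \<Longrightarrow> i < M \<Longrightarrow> x \<noteq> z ^ (4 * i + 4)"
    and k: "k \<le> M"
  shows "vwp_term z xs (M - k) = - vwp_term z xs k"
proof -
  define \<kappa> where "\<kappa> = (\<Prod>i<M. - (z ^ (4 * (M - Suc i) + 1)))"
  have one: "1 \<noteq> z ^ (4 * i + 4)" if "i < M" for i
    using power_neq_1[of "4 * i + 4"] that n by auto
  have "(\<Prod>x\<leftarrow>ys. wp x z (M - k)) = (\<kappa> * z ^ (3 * k)) ^ length ys * (\<Prod>x\<leftarrow>ys. wp x z k)"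
    if "set ys \<subseteq> insert 1 (set xs)" for ys
    using that
  proof (induction ys)
    case (Cons y ys)
    have "\<And>i. i < M \<Longrightarrow> y \<noteq> z ^ (4 * i + 4)" using Cons.prems x one by auto
    from wp_reflect[OF this k] wp_full[OF this] Cons show ?case by (simp add: \<kappa>_def mult_ac)
  qed simp
  from this[of "1 # xs"] len have P: "(\<Prod>x\<leftarrow>1 # xs. wp x z (M - k)) = (\<kappa> * z ^ (3 * k)) ^ 6 * (\<Prod>x\<leftarrow>1 # xs. wp x z k)"
    by (simp only: list.size) (simp add: subset_insertI)
  \<comment> \<open>Full reflection of the parameter 1 determines \<kappa>^2; its cube is what the
    six factors require.\<close>
  have "wp 1 z (M - M) = wp 1 z M * wp 1 z M * z ^ (3 * M)" using one by (intro wp_reflect) auto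
  then have \<kappa>2: "\<kappa>\<^sup>2 * z ^ (3 * M) = 1"
    using wp_full[of 1] one by (simp add: \<kappa>_def power2_eq_square)
  have "(\<kappa>\<^sup>2 * z ^ (3 * M)) ^ 3 = \<kappa> ^ 6 * z ^ (5 * M) * z ^ (4 * M)"
    by (simp add: power_mult_distrib flip: power_mult power_add)
  with \<kappa>2 have 1: "\<kappa> ^ 6 * z ^ (5 * M) * z ^ (4 * M) = 1" by simp
  have zM: "z ^ (4 * M) * z = 1" using root n by (simp add: mult.commute)
  have "\<kappa> ^ 6 * z ^ (5 * M) = \<kappa> ^ 6 * z ^ (5 * M) * (z ^ (4 * M) * z)" using zM by simp
  also have "\<dots> = z" using 1 by (simp add: mult.assoc[symmetric])
  finally have \<kappa>6: "\<kappa> ^ 6 * z ^ (5 * M) = z" .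
  have e: "18 * k + 5 * (M - k) = 5 * M + 8 * k + 5 * k" using k by simp
  have V: "(\<Prod>x\<leftarrow>1 # xs. wp x z (M - k)) * z ^ (5 * (M - k))
     = z ^ (8 * k + 1) * ((\<Prod>x\<leftarrow>1 # xs. wp x z k) * z ^ (5 * k))"
  proof -
    have "(\<Prod>x\<leftarrow>1 # xs. wp x z (M - k)) * z ^ (5 * (M - k))
       = \<kappa> ^ 6 * (z ^ (18 * k) * z ^ (5 * (M - k))) * (\<Prod>x\<leftarrow>1 # xs. wp x z k)"
      unfolding P by (simp add: power_mult_distrib mult_ac flip: power_mult)
    also have "z ^ (18 * k) * z ^ (5 * (M - k)) = z ^ (5 * M) * z ^ (8 * k) * z ^ (5 * k)"
      unfolding power_add[symmetric] e ..
    also have "\<kappa> ^ 6 * \<dots> = (\<kappa> ^ 6 * z ^ (5 * M)) * z ^ (8 * k) * z ^ (5 * k)" by (simp only: mult_ac)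
    finally show ?thesis unfolding \<kappa>6 by (simp add: mult_ac)
  qed
  have "8 * (M - k) + 1 + (8 * k + 1) = n * 2" using k n by simp
  then have "z ^ (8 * (M - k) + 1) * z ^ (8 * k + 1) = 1"
    using root by (simp only: power_add[symmetric] power_mult power_one)
  then have qi: "qint z (8 * (M - k) + 1) * z ^ (8 * k + 1) = - qint z (8 * k + 1)"
    by (simp add: qint_def left_diff_distrib minus_divide_left)
  show ?thesis unfolding vwp_term_def mult.assoc V unfolding mult.assoc[symmetric] qi by (simp only: mult_minus_left)
qed

text \<open>The logarithmic counterpart of \<open>wp_reflect\<close>: paired summands are opposite,
  because the product of paired factors does not depend on x.\<close>

lemma wp_log_deriv_reflect:
  assumes "k \<le> M"
  shows "wp_log_deriv z (M - k) = wp_log_deriv z M + wp_log_deriv z k"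
  using assms
proof (induction k)
  case 0
  then show ?case by (simp add: wp_log_deriv_def)
next
  case (Suc k)
  define e where "e = (\<lambda>i. (z ^ (8 * i + 5) - 1) / ((1 - z ^ (4 * i + 1)) * (1 - z ^ (4 * i + 4))))"
  define A B X Y where "A = z ^ (4 * (M - Suc k) + 1)" and "B = z ^ (4 * (M - Suc k) + 4)"
    and "X = z ^ (4 * k + 1)" and "Y = z ^ (4 * k + 4)"
  have AY: "A * Y = 1" and BX: "B * X = 1"
    using reflected_exponents[of k] Suc.prems by (simp_all add: A_def B_def X_def Y_def)
  have nz: "1 - A \<noteq> 0" "1 - B \<noteq> 0" "1 - X \<noteq> 0" "1 - Y \<noteq> 0"
    using Suc.prems n power_neq_1[of "4 * (M - Suc k) + 1"] power_neq_1[of "4 * (M - Suc k) + 4"]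
      power_neq_1[of "4 * k + 1"] power_neq_1[of "4 * k + 4"]
    by (auto simp: A_def B_def X_def Y_def)
  have AB: "z ^ (8 * (M - Suc k) + 5) = A * B" and XY: "z ^ (8 * k + 5) = X * Y"
    unfolding A_def B_def X_def Y_def power_add[symmetric] by (simp_all add: add_ac)
  have "(A * B - 1) * ((1 - X) * (1 - Y)) = - ((X * Y - 1) * ((1 - A) * (1 - B)))"
    using AY BX by algebra
  moreover have frac: "p / q = - (r / s)" if "p * s = - (r * q)" "q \<noteq> 0" "s \<noteq> 0" for p q r s :: 'a
    using that by (simp add: field_simps)
  ultimately have e: "e (M - Suc k) = - e k"
    unfolding e_def AB XY A_def[symmetric] B_def[symmetric] X_def[symmetric] Y_def[symmetric]
    using nz by (intro frac) simp_all
  have "M - k = Suc (M - Suc k)" using Suc.prems by simp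
  then have "wp_log_deriv z (M - k) = wp_log_deriv z (M - Suc k) + e (M - Suc k)"
    by (simp add: wp_log_deriv_def e_def)
  moreover have "wp_log_deriv z (Suc k) = wp_log_deriv z k + e k"
    by (simp add: wp_log_deriv_def e_def)
  ultimately show ?case using Suc e by (simp add: algebra_simps)
qed

text \<open>If 1 is an entry of \<open>xs\<close>, this sum is the derivative of the series in that
  entry. Under k -> M - k the terms change sign and the logarithmic derivative is invariant, so the
  sum equals its own negative.\<close>

lemma sum_vwp_term_log_deriv:
  assumes two: "(2::'a) \<noteq> 0" and len: "length xs = 5"
    and x: "\<And>x i. x \<in> set xs \<Longrightarrow> i < M \<Longrightarrow> x \<noteq> z ^ (4 * i + 4)"
  shows "(\<Sum>k\<le>M. vwp_term z xs k * wp_log_deriv z k) = 0"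
proof -
  have double_zero: "y = 0" if "y = - y" for y :: 'a
    using that two by (metis add.right_inverse mult_2 mult_eq_0_iff)
  \<comment> \<open>The left side is an empty sum, so twice \<open>wp_log_deriv z M\<close> is zero
    and the additive constant of the reflection disappears.\<close>
  have "wp_log_deriv z (M - M) = wp_log_deriv z M + wp_log_deriv z M"
    by (rule wp_log_deriv_reflect) simp
  then have "wp_log_deriv z M = - wp_log_deriv z M"
    by (simp add: wp_log_deriv_def eq_neg_iff_add_eq_0)
  then have M: "wp_log_deriv z M = 0" by (rule double_zero)
  let ?f = "\<lambda>k. vwp_term z xs k * wp_log_deriv z k"
  have "(\<Sum>k\<le>M. ?f k) = (\<Sum>k\<le>M. ?f (M - k))"
    using sum.atLeastAtMost_rev[of ?f 0 M] by (simp add: atMost_atLeast0)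
  also have "\<dots> = (\<Sum>k\<le>M. - ?f k)"
    by (rule sum.cong) (simp_all add: vwp_term_reflect[OF len x] wp_log_deriv_reflect M)
  finally have "(\<Sum>k\<le>M. ?f k) = - (\<Sum>k\<le>M. ?f k)" by (simp add: sum_negf)
  then show ?thesis by (rule double_zero)
qed

section \<open>Equality of the two prefactors at a root of unity\<close>

lemma prod_split4: "(\<Prod>i\<in>{1..<n}. f i) = (\<Prod>i<M. f (4 * i + 1) * f (4 * i + 2) * f (4 * i + 3) * f (4 * i + 4))"
  for f :: "nat \<Rightarrow> 'b::comm_monoid_mult"
proof -
  have "(\<Prod>i\<in>{1..<4 * m + 1}. f i) = (\<Prod>i<m. f (4 * i + 1) * f (4 * i + 2) * f (4 * i + 3) * f (4 * i + 4))" for m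
  proof (induction m)
    case (Suc m)
    have "4 * Suc m + 1 = Suc (Suc (Suc (Suc (4 * m + 1))))" by simp
    then have "(\<Prod>i\<in>{1..<4 * Suc m + 1}. f i)
      = (\<Prod>i\<in>{1..<4 * m + 1}. f i) * (f (4 * m + 1) * f (4 * m + 2) * f (4 * m + 3) * f (4 * m + 4))"
      by (simp only:) (simp add: mult_ac numeral_eq_Suc)
    then show ?case using Suc by simp
  qed simp
  then show ?thesis using n by simp
qed

text \<open>Reversing the two products in 1/a turns the residues 2 and 4 into 3 and 1. The four
  products and 1 - a then run through all factors 1 - a z^i with i < n, whose product is 1 -
  a^n.\<close>

lemma prefactor_product:
  assumes a0: "a \<noteq> 0"
  shows "a ^ (2 * M) * (1 - a) * (qpoch (a * z\<^sup>2) (z ^ 4) M * qpoch (z\<^sup>2 / a) (z ^ 4) M)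
          * (qpoch (z ^ 4 * a) (z ^ 4) M * qpoch (z ^ 4 / a) (z ^ 4) M) = z ^ M * (1 - a ^ n)"
proof -
  have z4: "(z ^ 4) ^ i = z ^ (4 * i)" for i by (simp add: power_mult)
  \<comment> \<open>Always m + m' = 5, so the exponents 4(M-1-i) + m' and 4i + m add up to
    n.\<close>
  have rev: "a ^ M * qpoch (z ^ m / a) (z ^ 4) M = (\<Prod>i<M. - (z ^ (4 * i + m))) * (\<Prod>i<M. 1 - a * z ^ (4 * i + m'))"
    if m: "m = 2 \<and> m' = 3 \<or> m = 4 \<and> m' = 1" for m m'
  proof -
    have "a ^ M * qpoch (z ^ m / a) (z ^ 4) M = (\<Prod>i<M. a - z ^ (4 * i + m))"
    proof -
      have "a ^ M * qpoch (z ^ m / a) (z ^ 4) M = (\<Prod>i<M. a * (1 - z ^ m / a * (z ^ 4) ^ i))"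
        by (simp add: qpoch_def prod.distrib)
      also have "\<dots> = (\<Prod>i<M. a - z ^ (4 * i + m))"
        using a0 by (intro prod.cong) (simp_all add: right_diff_distrib z4 power_add)
      finally show ?thesis .
    qed
    also have "\<dots> = (\<Prod>i<M. - (z ^ (4 * i + m)) * (1 - a * z ^ (4 * (M - Suc i) + m')))"
    proof (rule prod.cong[OF refl])
      fix i assume "i \<in> {..<M}"
      then have "z ^ (4 * (M - Suc i) + m') * z ^ (4 * i + m) = 1"
        using reflected_exponents[of i] m by auto
      then show "a - z ^ (4 * i + m) = - (z ^ (4 * i + m)) * (1 - a * z ^ (4 * (M - Suc i) + m'))"
        by (simp add: right_diff_distrib mult_ac)
    qed
    also have "\<dots> = (\<Prod>i<M. - (z ^ (4 * i + m))) * (\<Prod>i<M. 1 - a * z ^ (4 * (M - Suc i) + m'))"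
      by (rule prod.distrib)
    also have "(\<Prod>i<M. 1 - a * z ^ (4 * (M - Suc i) + m')) = (\<Prod>i<M. 1 - a * z ^ (4 * i + m'))"
      by (rule prod.nat_diff_reindex)
    finally show ?thesis .
  qed
  have r2: "a ^ M * qpoch (z\<^sup>2 / a) (z ^ 4) M = (\<Prod>i<M. - (z ^ (4 * i + 2))) * (\<Prod>i<M. 1 - a * z ^ (4 * i + 3))"
    by (rule rev) simp
  have r4: "a ^ M * qpoch (z ^ 4 / a) (z ^ 4) M = (\<Prod>i<M. - (z ^ (4 * i + 4))) * (\<Prod>i<M. 1 - a * z ^ (4 * i + 1))"
    by (rule rev) simp
  have a2: "a ^ (2 * M) = a ^ M * a ^ M" by (simp add: mult_2 power_add)
  have fwd: "qpoch (a * z\<^sup>2) (z ^ 4) M = (\<Prod>i<M. 1 - a * z ^ (4 * i + 2))"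
    "qpoch (z ^ 4 * a) (z ^ 4) M = (\<Prod>i<M. 1 - a * z ^ (4 * i + 4))"
    by (simp_all only: qpoch_def z4 power_add mult_ac)
  have c: "(\<Prod>i<m. - (z ^ (4 * i + 2))) * (\<Prod>i<m. - (z ^ (4 * i + 4))) = z ^ (4 * m * m + 2 * m)" for m
  proof (induction m)
    case (Suc m)
    have e: "4 * Suc m * Suc m + 2 * Suc m = 4 * m * m + 2 * m + (4 * m + 2) + (4 * m + 4)"
      by (simp add: algebra_simps)
    have "(\<Prod>i<Suc m. - (z ^ (4 * i + 2))) * (\<Prod>i<Suc m. - (z ^ (4 * i + 4)))
      = ((\<Prod>i<m. - (z ^ (4 * i + 2))) * (\<Prod>i<m. - (z ^ (4 * i + 4)))) * z ^ (4 * m + 2) * z ^ (4 * m + 4)"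
      by (simp only: prod.lessThan_Suc mult_minus_left mult_minus_right minus_minus mult_ac)
    then show ?case
      unfolding Suc.IH e power_add[of z "4 * m * m + 2 * m + (4 * m + 2)"] power_add[of z "4 * m * m + 2 * m" "4 * m + 2"] .
  qed simp
  \<comment> \<open>The sign-free power left over from the reversals is reduced by z^n = 1.\<close>
  have "4 * M * M + 2 * M = n * M + M" by (simp add: n)
  then have c': "z ^ (4 * M * M + 2 * M) = z ^ M" by (simp only: root power_add power_mult power_one mult_1)
  have "(\<Prod>i<n. 1 - a * z ^ i) = (1 - a) * (\<Prod>i\<in>{1..<n}. 1 - a * z ^ i)"
    using prod.atLeast_Suc_lessThan[of 0 n "\<lambda>i. 1 - a * z ^ i"] n_pos by (simp add: lessThan_atLeast0)
  then have all: "(1 - a) * (\<Prod>i<M. (1 - a * z ^ (4 * i + 1)) * (1 - a * z ^ (4 * i + 2)) * (1 - a * z ^ (4 * i + 3)) * (1 - a * z ^ (4 * i + 4))) = 1 - a ^ n"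
    by (simp only: prod_one_minus prod_split4)
  have "a ^ (2 * M) * (1 - a) * (qpoch (a * z\<^sup>2) (z ^ 4) M * qpoch (z\<^sup>2 / a) (z ^ 4) M)
          * (qpoch (z ^ 4 * a) (z ^ 4) M * qpoch (z ^ 4 / a) (z ^ 4) M)
     = (1 - a) * (a ^ M * qpoch (z ^ 2 / a) (z ^ 4) M) * (a ^ M * qpoch (z ^ 4 / a) (z ^ 4) M)
        * qpoch (a * z\<^sup>2) (z ^ 4) M * qpoch (z ^ 4 * a) (z ^ 4) M"
    unfolding a2 by (simp only: mult_ac)
  also have "\<dots> = ((\<Prod>i<M. - (z ^ (4 * i + 2))) * (\<Prod>i<M. - (z ^ (4 * i + 4))))
     * ((1 - a) * (\<Prod>i<M. (1 - a * z ^ (4 * i + 1)) * (1 - a * z ^ (4 * i + 2)) * (1 - a * z ^ (4 * i + 3)) * (1 - a * z ^ (4 * i + 4))))"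
    unfolding r2 r4 fwd prod.distrib by (simp only: mult_ac)
  also have "\<dots> = z ^ M * (1 - a ^ n)" unfolding c c' all ..
  finally show ?thesis .
qed

text \<open>At q^n = 1 the first two factors of h become -(1 - a)^2 and cancel the denominator. The
  first term in the braces then removes the quotient in front; the second is matched with the left
  side by \<open>prefactor_product\<close> and by writing n as the product of all 1 - z^i, 0 < i <
  n.\<close>

lemma prefactor_eq:
  assumes a0: "a \<noteq> 0" and an: "a ^ n \<noteq> 1"
  shows "qpoch z (z ^ 4) M * qpoch (z ^ 3) (z ^ 4) M
         / (qpoch (z ^ 4 * a) (z ^ 4) M * qpoch (z ^ 4 / a) (z ^ 4) M)
     = 1 / z ^ M * (qpoch (z\<^sup>2) (z ^ 4) M / qpoch (z ^ 4) (z ^ 4) M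
         + h_fun n z a / ((1 - a)\<^sup>2 * (1 - a ^ n) * qpochs [z\<^sup>2, z ^ 4] (z ^ 4) M))"
proof -
  define P where "P = (\<lambda>x. qpoch x (z ^ 4) M)"
  have a1: "1 - a \<noteq> 0" and an': "1 - a ^ n \<noteq> 0" using an by auto
  have z4: "(z ^ 4) ^ i = z ^ (4 * i)" for i by (simp add: power_mult)
  have Pz: "P (z ^ m) = (\<Prod>i<M. 1 - z ^ (4 * i + m))" for m
    by (simp add: P_def qpoch_def z4 add.commute flip: power_add)
  have prod4: "P z * P (z\<^sup>2) * P (z ^ 3) * P (z ^ 4) = of_nat n"
    unfolding prod_one_minus_powers[symmetric] prod_split4
    using Pz[of 1] by (simp add: Pz prod.distrib)
  have nz: "P (z\<^sup>2) \<noteq> 0" "P (z ^ 4) \<noteq> 0"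
  proof -
    have "1 - z ^ (4 * i + 2) \<noteq> 0" "1 - z ^ (4 * i + 4) \<noteq> 0" if "i < M" for i
      using power_neq_1[of "4 * i + 2"] power_neq_1[of "4 * i + 4"] that n by auto
    then show "P (z\<^sup>2) \<noteq> 0" "P (z ^ 4) \<noteq> 0" unfolding Pz by auto
  qed
  have full: "a ^ (2 * M) * (1 - a) * (P (a * z\<^sup>2) * P (z\<^sup>2 / a)) * (P (z ^ 4 * a) * P (z ^ 4 / a)) = z ^ M * (1 - a ^ n)"
    using prefactor_product[OF a0] by (simp add: P_def)
  have nz': "P (z ^ 4 * a) * P (z ^ 4 / a) \<noteq> 0" and z0: "z ^ M \<noteq> 0"
    using full an' z_nonzero by auto
  have "h_fun n z a = - (1 - a)\<^sup>2 * ((P (z\<^sup>2))\<^sup>2 * (1 - a ^ n) - of_nat n * (P (a * z\<^sup>2) * P (z\<^sup>2 / a)) * (1 - a) * a ^ (2 * M))"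
  proof -
    have "(n - 1) div 4 = M" "(n - 1) div 2 = 2 * M" using n by simp_all
    moreover have "(1 - a) * (a - 1) = - (1 - a)\<^sup>2" by (simp add: power2_eq_square algebra_simps)
    ultimately show ?thesis by (simp only: h_fun_def P_def root mult_1_right qpochs_Cons qpochs_Nil)
  qed
  then have "P (z\<^sup>2) / P (z ^ 4) + h_fun n z a / ((1 - a)\<^sup>2 * (1 - a ^ n) * (P (z\<^sup>2) * P (z ^ 4)))
    = P (z\<^sup>2) / P (z ^ 4) - ((P (z\<^sup>2))\<^sup>2 * (1 - a ^ n) - of_nat n * (P (a * z\<^sup>2) * P (z\<^sup>2 / a)) * (1 - a) * a ^ (2 * M))
      / ((1 - a ^ n) * (P (z\<^sup>2) * P (z ^ 4)))"
    using a1 by simp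
  also have "\<dots> = of_nat n * (P (a * z\<^sup>2) * P (z\<^sup>2 / a)) * (1 - a) * a ^ (2 * M) / ((1 - a ^ n) * (P (z\<^sup>2) * P (z ^ 4)))"
  proof -
    have "p / s - (p\<^sup>2 * w - X) / (w * (p * s)) = X / (w * (p * s))" if "p \<noteq> 0" "s \<noteq> 0" "w \<noteq> 0" for p s w X :: 'a
      using that by (simp add: field_simps power2_eq_square)
    then show ?thesis using nz an' by blast
  qed
  finally have R: "P (z\<^sup>2) / P (z ^ 4) + h_fun n z a / ((1 - a)\<^sup>2 * (1 - a ^ n) * (P (z\<^sup>2) * P (z ^ 4))) = \<dots>" .
  have "P z * P (z ^ 3) / (P (z ^ 4 * a) * P (z ^ 4 / a)) = 1 / z ^ M * \<dots>"
  proof -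
    have eq: "P z * P (z ^ 3) * (z ^ M * (1 - a ^ n)) * (P (z\<^sup>2) * P (z ^ 4))
       = of_nat n * (P (a * z\<^sup>2) * P (z\<^sup>2 / a)) * (1 - a) * a ^ (2 * M) * (P (z ^ 4 * a) * P (z ^ 4 / a))"
      unfolding prod4[symmetric] full[symmetric] by (simp only: mult_ac)
    have frac: "L / D = 1 / Z * (N / (w * E))" if "L * (Z * w) * E = N * D" "D \<noteq> 0" "Z \<noteq> 0" "w \<noteq> 0" "E \<noteq> 0"
      for L D Z N w E :: 'a
      using that by (simp add: frac_eq_eq mult_ac)
    show ?thesis by (rule frac[OF eq nz' z0 an']) (use nz in simp)
  qed
  then show ?thesis unfolding R[symmetric] by (simp add: P_def)
qed

end

section \<open>Congruences in a local ring\<close>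

text \<open>The sum on the right of the theorem with u, v, x, y left free, so that the versions
  shifted by q^n or q^(-n) fit the same shape.\<close>

definition phi_sum :: "nat \<Rightarrow> 'a::field \<Rightarrow> 'a \<Rightarrow> 'a \<Rightarrow> 'a \<Rightarrow> 'a \<Rightarrow> 'a \<Rightarrow> 'a \<Rightarrow> 'a" where
  "phi_sum M q u v c d x y = (\<Sum>k\<le>M. qpochs [u, q ^ 3 / (c * d), x, y] (q ^ 4) k
      / qpochs [v, q ^ 4, q ^ 4 / c, q ^ 4 / d] (q ^ 4) k * q ^ (4 * k))"

section \<open>Calculus of congruences in a local ring\<close>

text \<open>An abstraction of the ring of rational functions regular at a point; \<open>val\<close>
  is evaluation there, that is, the residue map.\<close>

locale local_subring =
  fixes R :: "'a::field set" and val :: "'a \<Rightarrow> complex"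
  assumes one_closed [simp]: "1 \<in> R" and val_one [simp]: "val 1 = 1"
    and add_closed [simp]: "\<lbrakk>x \<in> R; y \<in> R\<rbrakk> \<Longrightarrow> x + y \<in> R"
    and val_add [simp]: "\<lbrakk>x \<in> R; y \<in> R\<rbrakk> \<Longrightarrow> val (x + y) = val x + val y"
    and uminus_closed [simp]: "x \<in> R \<Longrightarrow> - x \<in> R"
    and val_uminus [simp]: "x \<in> R \<Longrightarrow> val (- x) = - val x"
    and mult_closed [simp]: "\<lbrakk>x \<in> R; y \<in> R\<rbrakk> \<Longrightarrow> x * y \<in> R"
    and val_mult [simp]: "\<lbrakk>x \<in> R; y \<in> R\<rbrakk> \<Longrightarrow> val (x * y) = val x * val y"
    and inverse_closed: "\<lbrakk>x \<in> R; val x \<noteq> 0\<rbrakk> \<Longrightarrow> inverse x \<in> R"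
begin

lemma diff_closed [simp]: "\<lbrakk>x \<in> R; y \<in> R\<rbrakk> \<Longrightarrow> x - y \<in> R"
  using add_closed[of x "- y"] by simp

lemma val_diff [simp]: "\<lbrakk>x \<in> R; y \<in> R\<rbrakk> \<Longrightarrow> val (x - y) = val x - val y"
  using val_add[of x "- y"] by simp

lemma zero_closed [simp]: "0 \<in> R"
  using diff_closed[of 1 1] by simp

lemma val_zero [simp]: "val 0 = 0"
  using val_diff[of 1 1] by simp

lemma divide_closed [simp]: "\<lbrakk>x \<in> R; y \<in> R; val y \<noteq> 0\<rbrakk> \<Longrightarrow> x / y \<in> R"
  by (simp add: divide_inverse inverse_closed)

lemma val_divide [simp]:
  assumes "x \<in> R" "y \<in> R" "val y \<noteq> 0"
  shows "val (x / y) = val x / val y"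
proof -
  have "y \<noteq> 0" using assms by auto
  then have "val x = val (x / y * y)" by simp
  also have "\<dots> = val (x / y) * val y" using assms by (intro val_mult) auto
  finally show ?thesis using assms by simp
qed

lemma power_closed [simp]: "x \<in> R \<Longrightarrow> x ^ k \<in> R"
  by (induction k) auto

lemma val_power [simp]: "x \<in> R \<Longrightarrow> val (x ^ k) = val x ^ k"
  by (induction k) auto

lemma of_nat_closed [simp]: "of_nat k \<in> R"
  by (induction k) auto

lemma sum_closed: "(\<And>i. i \<in> A \<Longrightarrow> f i \<in> R) \<Longrightarrow> sum f A \<in> R"
  by (induction A rule: infinite_finite_induct) auto

lemma prod_closed: "(\<And>i. i \<in> A \<Longrightarrow> f i \<in> R) \<Longrightarrow> prod f A \<in> R"
  by (induction A rule: infinite_finite_induct) auto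

lemma val_prod: "(\<And>i. i \<in> A \<Longrightarrow> f i \<in> R) \<Longrightarrow> val (prod f A) = (\<Prod>i\<in>A. val (f i))"
  by (induction A rule: infinite_finite_induct) (auto simp: prod_closed)

lemma qpoch_closed [simp]: "\<lbrakk>x \<in> R; q \<in> R\<rbrakk> \<Longrightarrow> qpoch x q k \<in> R"
  by (auto simp: qpoch_def intro!: prod_closed)

lemma val_qpoch [simp]: "\<lbrakk>x \<in> R; q \<in> R\<rbrakk> \<Longrightarrow> val (qpoch x q k) = qpoch (val x) (val q) k"
  by (simp add: qpoch_def val_prod)

text \<open>Membership of both sides and of the quotient in \<open>R\<close> records that no
  denominator vanishes at the point.\<close>

definition lcong :: "'a \<Rightarrow> 'a \<Rightarrow> 'a \<Rightarrow> bool" where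
  "lcong p x y \<longleftrightarrow> x \<in> R \<and> y \<in> R \<and> (\<exists>w\<in>R. x - y = p * w)"

lemma lcongD: "lcong p x y \<Longrightarrow> x \<in> R" "lcong p x y \<Longrightarrow> y \<in> R"
  by (auto simp: lcong_def)

lemma lcongI: "\<lbrakk>x \<in> R; y \<in> R; w \<in> R; x - y = p * w\<rbrakk> \<Longrightarrow> lcong p x y"
  by (auto simp: lcong_def)

lemma lcongE:
  assumes "lcong p x y"
  obtains w where "w \<in> R" "x - y = p * w"
  using assms by (auto simp: lcong_def)

lemma lcong_refl [simp]: "x \<in> R \<Longrightarrow> lcong p x x"
  by (rule lcongI[of _ _ 0]) auto

lemma lcong_sym:
  assumes "lcong p x y" shows "lcong p y x"
proof -
  obtain w where w: "w \<in> R" "x - y = p * w" using assms by (rule lcongE)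
  then show ?thesis using lcongD[OF assms]
    by (intro lcongI[of _ _ "- w"]) (auto simp flip: w(2))
qed

lemma lcong_trans [trans]:
  assumes "lcong p x y" "lcong p y z" shows "lcong p x z"
proof -
  obtain u w where uw: "u \<in> R" "w \<in> R" "x - y = p * u" "y - z = p * w"
    using assms by (meson lcongE)
  have "x - z = p * (u + w)" unfolding distrib_left uw(3,4)[symmetric] by simp
  then show ?thesis using lcongD[OF assms(1)] lcongD[OF assms(2)] uw by (intro lcongI[of _ _ "u + w"]) auto
qed

lemma lcong_eq_trans [trans]: "lcong p x y \<Longrightarrow> y = z \<Longrightarrow> lcong p x z" "x = y \<Longrightarrow> lcong p y z \<Longrightarrow> lcong p x z"
  by auto

lemma lcong_add:
  assumes "lcong p x y" "lcong p x' y'" shows "lcong p (x + x') (y + y')"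
proof -
  obtain u w where uw: "u \<in> R" "w \<in> R" "x - y = p * u" "x' - y' = p * w"
    using assms by (meson lcongE)
  have "x + x' - (y + y') = p * (u + w)" unfolding distrib_left uw(3,4)[symmetric] by simp
  then show ?thesis using lcongD[OF assms(1)] lcongD[OF assms(2)] uw by (intro lcongI[of _ _ "u + w"]) auto
qed

lemma lcong_mult:
  assumes "lcong p x y" "lcong p x' y'" shows "lcong p (x * x') (y * y')"
proof -
  obtain u w where uw: "u \<in> R" "w \<in> R" "x - y = p * u" "x' - y' = p * w"
    using assms by (meson lcongE)
  have "x * x' - y * y' = (x - y) * x' + y * (x' - y')" by (simp add: algebra_simps)
  also have "\<dots> = p * (u * x' + y * w)" unfolding uw by (simp add: algebra_simps)
  finally show ?thesis using lcongD[OF assms(1)] lcongD[OF assms(2)] uw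
    by (intro lcongI[of _ _ "u * x' + y * w"]) auto
qed

lemma lcong_diff:
  assumes "lcong p x y" "lcong p x' y'" shows "lcong p (x - x') (y - y')"
  using lcong_add[OF assms(1) lcong_mult[OF lcong_refl[of "- 1"] assms(2)]] by simp

lemma lcong_divide:
  assumes "lcong p x y" "lcong p x' y'" "val x' \<noteq> 0" "val y' \<noteq> 0"
  shows "lcong p (x / x') (y / y')"
proof -
  obtain w where w: "w \<in> R" "x' - y' = p * w" using assms(2) by (rule lcongE)
  have nz: "x' \<noteq> 0" "y' \<noteq> 0" using assms by auto
  have "lcong p (1 / x') (1 / y')"
  proof (rule lcongI[of _ _ "- w / (x' * y')"])
    show "1 / x' - 1 / y' = p * (- w / (x' * y'))"
    proof -
      have "1 / x' - 1 / y' = (y' - x') / (x' * y')" using nz by (simp add: diff_frac_eq)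
      also have "y' - x' = p * (- w)" by (metis minus_diff_eq mult_minus_right w(2))
      finally show ?thesis by simp
    qed
  qed (use assms lcongD[OF assms(2)] w in auto)
  from lcong_mult[OF assms(1) this] show ?thesis by simp
qed

lemma lcong_power: "lcong p x y \<Longrightarrow> lcong p (x ^ k) (y ^ k)"
  by (induction k) (auto intro: lcong_mult)

lemma lcong_sum: "(\<And>i. i \<in> A \<Longrightarrow> lcong p (f i) (g i)) \<Longrightarrow> lcong p (sum f A) (sum g A)"
  by (induction A rule: infinite_finite_induct) (auto intro: lcong_add)

lemma lcong_prod: "(\<And>i. i \<in> A \<Longrightarrow> lcong p (f i) (g i)) \<Longrightarrow> lcong p (prod f A) (prod g A)"
  by (induction A rule: infinite_finite_induct) (auto intro: lcong_mult)

lemma lcong_qpoch: "\<lbrakk>lcong p x y; lcong p q r\<rbrakk> \<Longrightarrow> lcong p (qpoch x q k) (qpoch y r k)"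
  unfolding qpoch_def by (intro lcong_prod lcong_diff lcong_mult lcong_power) auto

text \<open>A known factor p doubles the precision. It is used with the derivative term and with
  [n], both multiples of p.\<close>

lemma lcong_lift:
  assumes "lcong p x y" "h \<in> R" "p \<in> R" shows "lcong (p\<^sup>2) (p * h * x) (p * h * y)"
proof -
  obtain w where w: "w \<in> R" "x - y = p * w" using assms(1) by (rule lcongE)
  have "p * h * x - p * h * y = p\<^sup>2 * (h * w)"
    using w(2) by (simp add: power2_eq_square flip: right_diff_distrib)
  then show ?thesis using lcongD[OF assms(1)] assms(2,3) w by (intro lcongI[of _ _ "h * w"]) auto
qed

lemma lcong_val_eq:
  assumes "lcong p x y" "p \<in> R" "val p = 0"
  shows "val x = val y"
proof -
  obtain w where "w \<in> R" "x - y = p * w" using assms(1) by (rule lcongE)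
  then have "val (x - y) = 0" using assms by simp
  then show ?thesis using lcongD[OF assms(1)] by simp
qed

section \<open>Congruences for the building blocks of the two sides\<close>

lemma lcong_wp:
  assumes "lcong p x y" "lcong p q r"
    and "\<And>i. i < k \<Longrightarrow> val x \<noteq> val q ^ (4 * i + 4)" "\<And>i. i < k \<Longrightarrow> val y \<noteq> val r ^ (4 * i + 4)"
  shows "lcong p (wp x q k) (wp y r k)"
  unfolding wp_def
  by (intro lcong_prod lcong_divide lcong_diff lcong_mult lcong_power)
    (use assms lcongD[OF assms(1)] lcongD[OF assms(2)] in \<open>simp_all del: power_Suc\<close>)

lemma lcong_qint: "\<lbrakk>lcong p q r; val q \<noteq> 1; val r \<noteq> 1\<rbrakk> \<Longrightarrow> lcong p (qint q m) (qint r m)"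
  unfolding qint_def
  by (intro lcong_divide lcong_diff lcong_power) (auto dest: lcongD)

lemma lcong_vwp_term:
  assumes xs: "list_all2 (lcong p) xs ys" and q: "lcong p q r"
    and vx: "\<And>x i. x \<in> set xs \<Longrightarrow> i < k \<Longrightarrow> val x \<noteq> val q ^ (4 * i + 4)"
    and vy: "\<And>y i. y \<in> set ys \<Longrightarrow> i < k \<Longrightarrow> val y \<noteq> val r ^ (4 * i + 4)"
    and v1: "val q \<noteq> 1" "val r \<noteq> 1"
      "\<And>i. i < k \<Longrightarrow> val q ^ (4 * i + 4) \<noteq> 1" "\<And>i. i < k \<Longrightarrow> val r ^ (4 * i + 4) \<noteq> 1"
  shows "lcong p (vwp_term q xs k) (vwp_term r ys k)"
proof -
  have "lcong p (\<Prod>x\<leftarrow>xs. wp x q k) (\<Prod>x\<leftarrow>ys. wp x r k)"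
    using xs vx vy
  proof (induction xs ys rule: list_all2_induct)
    case (Cons x xs y ys)
    then show ?case by (auto intro!: lcong_mult lcong_wp q)
  qed simp
  moreover have "lcong p (wp 1 q k) (wp 1 r k)"
    by (rule lcong_wp) (use v1 q in \<open>auto simp: eq_commute[of 1]\<close>)
  ultimately show ?thesis unfolding vwp_term_def list.map prod_list.Cons
    by (intro lcong_mult lcong_qint lcong_power q v1)
qed

lemma lcong_phi_sum:
  assumes "lcong p u u'" "lcong p v v'" "lcong p x x'" "lcong p y y'"
    and q: "q \<in> R" and c: "c \<in> R" "val c \<noteq> 0" and d: "d \<in> R" "val d \<noteq> 0"
    and vv: "\<And>i. i < M \<Longrightarrow> val v * val q ^ (4 * i) \<noteq> 1" "\<And>i. i < M \<Longrightarrow> val v' * val q ^ (4 * i) \<noteq> 1"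
    and vq: "\<And>i. i < M \<Longrightarrow> val q ^ (4 * i + 4) \<noteq> 1"
    and vc: "\<And>i. val c \<noteq> val q ^ i" and vd: "\<And>i. val d \<noteq> val q ^ i"
  shows "lcong p (phi_sum M q u v c d x y) (phi_sum M q u' v' c d x' y')"
  unfolding phi_sum_def
proof (rule lcong_sum)
  fix k assume "k \<in> {..M}"
  then have k: "k \<le> M" by simp
  have v: "v \<in> R" "v' \<in> R" using lcongD[OF assms(2)] .
  have nz: "qpoch (val v) (val q ^ 4) k \<noteq> 0" "qpoch (val v') (val q ^ 4) k \<noteq> 0" "qpoch (val q ^ 4) (val q ^ 4) k \<noteq> 0"
    "qpoch (val q ^ 4 / val c) (val q ^ 4) k \<noteq> 0" "qpoch (val q ^ 4 / val d) (val q ^ 4) k \<noteq> 0"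
  proof -
    have e: "(val q ^ 4) ^ i = val q ^ (4 * i)" "val q ^ 4 * val q ^ (4 * i) = val q ^ (4 * i + 4)" for i
      by (simp_all add: power_mult power_add)
    show "qpoch (val v) (val q ^ 4) k \<noteq> 0" "qpoch (val v') (val q ^ 4) k \<noteq> 0" "qpoch (val q ^ 4) (val q ^ 4) k \<noteq> 0"
      using vv vq k unfolding qpoch_eq_0_iff e by auto
    show "qpoch (val q ^ 4 / val c) (val q ^ 4) k \<noteq> 0" "qpoch (val q ^ 4 / val d) (val q ^ 4) k \<noteq> 0"
      using vc[THEN not_sym] vd[THEN not_sym] c d unfolding qpoch_eq_0_iff e times_divide_eq_left
      by (auto simp del: power_Suc)
  qed
  show "lcong p (qpochs [u, q ^ 3 / (c * d), x, y] (q ^ 4) k / qpochs [v, q ^ 4, q ^ 4 / c, q ^ 4 / d] (q ^ 4) k * q ^ (4 * k))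
    (qpochs [u', q ^ 3 / (c * d), x', y'] (q ^ 4) k / qpochs [v', q ^ 4, q ^ 4 / c, q ^ 4 / d] (q ^ 4) k * q ^ (4 * k))"
    unfolding qpochs_Cons qpochs_Nil
    by (intro lcong_mult lcong_divide lcong_qpoch lcong_refl assms) (use q c d v nz in simp_all)
qed

section \<open>The congruence modulo a - q^n and 1 - a q^n\<close>

text \<open>Both linear factors are treated at once, since both sums are symmetric in a and 1/a.
  Replacing a by a power of q reduces the left side to \<open>watson_at_a\<close> and makes h
  vanish.\<close>

lemma lcong_mod_a:
  assumes O: "q \<in> R" "a \<in> R" "c \<in> R" "d \<in> R" and p: "p \<in> R" "val p = 0" and n: "n = 4 * M + 1"
    and nz: "val q \<noteq> 0" "val a \<noteq> 0" "val c \<noteq> 0" "val d \<noteq> 0"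
    and vq: "\<And>i. 0 < i \<Longrightarrow> val q ^ i \<noteq> 1"
    and vc: "\<And>i. val c \<noteq> val q ^ i" and vd: "\<And>i. val d \<noteq> val q ^ i"
    and a: "lcong p a (q ^ n) \<or> lcong p a (1 / q ^ n)"
  defines "Q \<equiv> \<lambda>x. qpoch x (q ^ 4) M"
  shows "lcong p (\<Sum>k\<le>M. vwp_term q [c, d, 1, a, 1 / a] k)
     ((1 / q ^ M * qint q n * (Q (q\<^sup>2) / Q (q ^ 4))
       + 1 / q ^ M * qint q n * (h_fun n q a / ((1 - a)\<^sup>2 * (1 - a ^ n) * qpochs [q\<^sup>2, q ^ 4] (q ^ 4) M)))
      * phi_sum M q q (q\<^sup>2) c d (a * q) (q / a))"
proof -
  note val_cong = lcong_val_eq[OF _ p]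
  have qn: "q ^ n \<in> R" "1 / q ^ n \<in> R" "val (q ^ n) = val q ^ n" "val (1 / q ^ n) = 1 / val q ^ n"
    using O nz by auto
  have nz': "q \<noteq> 0" "a \<noteq> 0" "c \<noteq> 0" "d \<noteq> 0" using nz by auto
  have qi: "q ^ i \<noteq> 1" if "0 < i" for i
    using vq[OF that] O(1) by (metis val_one val_power)
  have ci: "c \<noteq> q ^ i" for i using vc[of i] O(1) by (metis val_power)
  have di: "d \<noteq> q ^ i" for i using vd[of i] O(1) by (metis val_power)
  have pow: "val q ^ i = val q ^ j \<longleftrightarrow> i = j" for i j
    by (rule power_eq_power_iff[OF nz(1) vq])
  have na: "n \<noteq> 4 * i + 4" for i unfolding n by presburger
  have vqn: "val q ^ n \<noteq> val q ^ (4 * i + 4)" "1 / val q ^ n \<noteq> val q ^ (4 * i + 4)" for i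
  proof -
    show "val q ^ n \<noteq> val q ^ (4 * i + 4)" unfolding pow by (rule na)
    have "val q ^ (4 * i + 4 + n) \<noteq> 1" by (rule vq) simp
    then show "1 / val q ^ n \<noteq> val q ^ (4 * i + 4)"
      using nz(1) unfolding power_add[of _ "4 * i + 4"] by (auto simp: divide_eq_eq)
  qed
  \<comment> \<open>x is whichever of q^n and q^(-n) is used to replace a, and y is its
    inverse.\<close>
  define x where "x = (if lcong p a (q ^ n) then q ^ n else 1 / q ^ n)"
  define y where "y = (if lcong p a (q ^ n) then 1 / q ^ n else q ^ n)"
  have ax: "lcong p a x" using a by (auto simp: x_def)
  have xy: "y = 1 / x" using nz' by (auto simp: x_def y_def)
  have xO: "x \<in> R" "y \<in> R" using qn by (auto simp: x_def y_def)
  have vx: "val x \<noteq> 0" using val_cong[OF ax] nz by simp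
  have ay: "lcong p (1 / a) y"
    unfolding xy by (rule lcong_divide) (use ax nz vx in auto)
  have vxy: "val x \<noteq> val q ^ (4 * i + 4)" "val y \<noteq> val q ^ (4 * i + 4)" for i
    using qn vqn[of i] by (auto simp: x_def y_def simp del: power_Suc)
  have va: "val a = val x" "val (1 / a) = val y" using val_cong[OF ax] val_cong[OF ay] by auto
  have a1: "1 / a \<in> R" using O nz by simp
  have v1: "val q ^ (4 * i + 4) \<noteq> 1" "val q ^ (4 * i + 2) \<noteq> 1" for i by (rule vq, simp)+
  have S: "lcong p (\<Sum>k\<le>M. vwp_term q [c, d, 1, a, 1 / a] k) (\<Sum>k\<le>M. vwp_term q [c, d, 1, x, y] k)"
  proof (rule lcong_sum, rule lcong_vwp_term)
    show "list_all2 (lcong p) [c, d, 1, a, 1 / a] [c, d, 1, x, y]"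
      using O ax ay by simp
    show "val u \<noteq> val q ^ (4 * i + 4)" if "u \<in> set [c, d, 1, a, 1 / a]" for u i
      using that vxy[of i] va vc[of "4 * i + 4"] vd[of "4 * i + 4"] v1[of i] by (auto simp: eq_commute[of 1])
    show "val u \<noteq> val q ^ (4 * i + 4)" if "u \<in> set [c, d, 1, x, y]" for u i
      using that vxy[of i] va vc[of "4 * i + 4"] vd[of "4 * i + 4"] v1[of i] by (auto simp: eq_commute[of 1])
    show "val q \<noteq> 1" "val q \<noteq> 1" using vq[of 1] by auto
  qed (use O v1 in auto)
  have "(\<Sum>k\<le>M. vwp_term q [c, d, 1, x, y] k) = (\<Sum>k\<le>M. vwp_term q [c, d, 1, q ^ n, 1 / q ^ n] k)"
    by (simp add: x_def y_def vwp_term_def mult_ac)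
  also have "\<dots> = 1 / q ^ M * qint q n * (Q (q\<^sup>2) / Q (q ^ 4))
       * phi_sum M q q (q\<^sup>2) c d (q ^ n * q) (1 / q ^ n * q)"
    unfolding phi_sum_def Q_def by (rule watson_at_a) (use nz' qi n ci di in auto)
  also have "phi_sum M q q (q\<^sup>2) c d (q ^ n * q) (1 / q ^ n * q) = phi_sum M q q (q\<^sup>2) c d (x * q) (y * q)"
    by (simp add: x_def y_def phi_sum_def mult_ac)
  finally have W: "(\<Sum>k\<le>M. vwp_term q [c, d, 1, x, y] k)
     = 1 / q ^ M * qint q n * (Q (q\<^sup>2) / Q (q ^ 4)) * phi_sum M q q (q\<^sup>2) c d (x * q) (y * q)" .
  have v2: "val (q\<^sup>2) * val q ^ (4 * i) \<noteq> 1" for i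
  proof -
    have "val (q\<^sup>2) * val q ^ (4 * i) = val q ^ (4 * i + 2)"
      using O(1) by (simp only: val_power power_add mult.commute)
    with v1(2)[of i] show ?thesis by (simp only: not_False_eq_True)
  qed
  have F: "lcong p (phi_sum M q q (q\<^sup>2) c d (x * q) (y * q)) (phi_sum M q q (q\<^sup>2) c d (a * q) (1 / a * q))"
    by (rule lcong_sym, rule lcong_phi_sum[OF lcong_refl lcong_refl lcong_mult[OF ax lcong_refl] lcong_mult[OF ay lcong_refl]])
      (rule O nz vc vd v1 v2 power_closed[OF O(1)])+
  have q4: "(val q ^ 4) ^ i = val q ^ (4 * i)" for i by (simp add: power_mult)
  have vQ: "val (Q (q ^ 4)) \<noteq> 0" "val (Q (q\<^sup>2)) \<noteq> 0"
  proof -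
    have e: "val q ^ 4 * (val q ^ 4) ^ i = val q ^ (4 * i + 4)" "(val q)\<^sup>2 * (val q ^ 4) ^ i = val q ^ (4 * i + 2)" for i
      by (simp_all only: q4 power_add mult.commute)
    show "val (Q (q ^ 4)) \<noteq> 0" "val (Q (q\<^sup>2)) \<noteq> 0"
      unfolding Q_def val_qpoch[OF power_closed[OF O(1)] power_closed[OF O(1)]] val_power[OF O(1)] qpoch_eq_0_iff e
      using v1 by blast+
  qed
  have QO: "Q (q ^ 4) \<in> R" "Q (q\<^sup>2) \<in> R" using O by (auto simp: Q_def)
  \<comment> \<open>At the point a^n takes the value q^(n*n) or its inverse, and q is not a root of
    unity there; so the denominator \<open>D\<close> is a unit.\<close>
  have va1: "val a \<noteq> 1" "val a ^ n \<noteq> 1"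
  proof -
    have "val a ^ n \<noteq> 1"
    proof -
      have "val q ^ (n * n) \<noteq> 1" by (rule vq) (simp add: n)
      moreover have "val a = val q ^ n \<or> val a = 1 / val q ^ n" using va qn by (auto simp: x_def)
      ultimately show ?thesis by (auto simp: power_mult power_one_over)
    qed
    then show "val a ^ n \<noteq> 1" "val a \<noteq> 1" by auto
  qed
  define D where "D = (1 - a)\<^sup>2 * (1 - a ^ n) * qpochs [q\<^sup>2, q ^ 4] (q ^ 4) M"
  have DO: "D \<in> R" "val D \<noteq> 0" using O QO vQ va1 by (auto simp: D_def Q_def)
  have uO: "1 / q ^ M * qint q n \<in> R" using O nz vq[of 1] by (auto simp: qint_def)
  have h: "lcong p (h_fun n q a) 0"
  proof -
    define E where "E = (qpoch (q^2) (q^4) ((n - 1) div 4))^2 * (1 - a ^ n)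
       - of_nat n * qpochs [a * q^2, q^2 / a] (q^4) ((n - 1) div 4) * (1 - a) * a ^ ((n - 1) div 2)"
    have EO: "E \<in> R" using O nz by (simp add: E_def)
    \<comment> \<open>After replacing a by x one of these two factors is zero, whichever choice x
      is.\<close>
    have "lcong p ((1 - a * q ^ n) * (a - q ^ n)) ((1 - x * q ^ n) * (x - q ^ n))"
      by (intro lcong_mult lcong_diff ax lcong_refl) (use O in auto)
    also have "(1 - x * q ^ n) * (x - q ^ n) = 0" using nz' by (auto simp: x_def)
    finally have "lcong p ((1 - a * q ^ n) * (a - q ^ n) * E) (0 * E)"
      using EO by (intro lcong_mult) auto
    then show ?thesis by (simp add: h_fun_def E_def)
  qed
  have Z: "lcong p (1 / q ^ M * qint q n * (h_fun n q a / D)) 0"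
    using lcong_mult[OF lcong_refl[OF uO] lcong_divide[OF h lcong_refl[OF DO(1)] DO(2) DO(2)]] by simp
  have "1 / q ^ M * qint q n * (Q (q\<^sup>2) / Q (q ^ 4)) \<in> R"
    using QO vQ by (intro mult_closed[OF uO] divide_closed)
  then have "lcong p (1 / q ^ M * qint q n * (Q (q\<^sup>2) / Q (q ^ 4)) + 0)
      (1 / q ^ M * qint q n * (Q (q\<^sup>2) / Q (q ^ 4)) + 1 / q ^ M * qint q n * (h_fun n q a / D))"
    by (intro lcong_add[OF lcong_refl lcong_sym[OF Z]])
  from lcong_mult[OF this F] have "lcong p (\<Sum>k\<le>M. vwp_term q [c, d, 1, x, y] k)
     ((1 / q ^ M * qint q n * (Q (q\<^sup>2) / Q (q ^ 4)) + 1 / q ^ M * qint q n * (h_fun n q a / D))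
       * phi_sum M q q (q\<^sup>2) c d (a * q) (1 / a * q))"
    unfolding W by simp
  from lcong_trans[OF S this] show ?thesis by (simp add: D_def)
qed


section \<open>The congruence modulo (q - \<zeta>)^2\<close>

lemma wp_closed:
  assumes "x \<in> R" "q \<in> R" "\<And>i. i < k \<Longrightarrow> val x \<noteq> val q ^ (4 * i + 4)"
  shows "wp x q k \<in> R"
  \<comment> \<open>Membership is read off from the congruence of the term with itself.\<close>
  by (rule lcongD(1)[where p = 0], rule lcong_wp[of _ x x q q]) (use assms in auto)

lemma vwp_term_closed:
  assumes "set xs \<subseteq> R" "q \<in> R" "\<And>x i. x \<in> set xs \<Longrightarrow> i < k \<Longrightarrow> val x \<noteq> val q ^ (4 * i + 4)"
    "val q \<noteq> 1" "\<And>i. i < k \<Longrightarrow> val q ^ (4 * i + 4) \<noteq> 1"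
  shows "vwp_term q xs k \<in> R"
proof -
  have "list_all2 (lcong 0) xs xs" using assms(1) by (induction xs) auto
  from lcongD(1)[OF lcong_vwp_term[OF this lcong_refl[OF assms(2)]]] assms(3-5) show ?thesis by blast
qed

lemma lcong_log_deriv:
  assumes q: "lcong p q r"
    and v: "\<And>i. i < k \<Longrightarrow> val q ^ (4 * i + 1) \<noteq> 1" "\<And>i. i < k \<Longrightarrow> val q ^ (4 * i + 4) \<noteq> 1"
      "\<And>i. i < k \<Longrightarrow> val r ^ (4 * i + 1) \<noteq> 1" "\<And>i. i < k \<Longrightarrow> val r ^ (4 * i + 4) \<noteq> 1"
  shows "lcong p (wp_log_deriv q k) (wp_log_deriv r k)"
  unfolding wp_log_deriv_def
proof (rule lcong_sum)
  fix i assume "i \<in> {..<k}"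
  then have i: "i < k" by simp
  show "lcong p ((q ^ (8 * i + 5) - 1) / ((1 - q ^ (4 * i + 1)) * (1 - q ^ (4 * i + 4))))
      ((r ^ (8 * i + 5) - 1) / ((1 - r ^ (4 * i + 1)) * (1 - r ^ (4 * i + 4))))"
    by (intro lcong_divide lcong_mult lcong_diff lcong_power q lcong_refl one_closed)
      (use v[OF i] lcongD[OF q] in \<open>simp_all del: power_Suc\<close>)
qed

text \<open>First-order Taylor expansion at b = 1, proved factor by factor; all second-order terms
  are multiples of p^2.\<close>

lemma lcong_wp_expand:
  assumes O: "q \<in> R" "p \<in> R" "h \<in> R" and vp: "val p = 0" and \<beta>: "\<beta> = 1 + p * h"
  shows "(\<And>i. i < k \<Longrightarrow> val q ^ (4 * i + 1) \<noteq> 1) \<Longrightarrow> (\<And>i. i < k \<Longrightarrow> val q ^ (4 * i + 4) \<noteq> 1) \<Longrightarrow>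
    lcong (p\<^sup>2) (wp \<beta> q k) (wp 1 q k * (1 + p * h * wp_log_deriv q k))"
proof (induction k)
  case 0
  then show ?case by (simp add: wp_log_deriv_def)
next
  case (Suc k)
  define X Y where "X = q ^ (4 * k + 1)" and "Y = q ^ (4 * k + 4)"
  have XY: "q ^ (8 * k + 5) = X * Y" unfolding X_def Y_def power_add[symmetric] by (simp add: add_ac)
  have OXY: "X \<in> R" "Y \<in> R" "\<beta> \<in> R" using O by (auto simp: X_def Y_def \<beta>)
  have v\<beta>: "val \<beta> = 1" using O vp by (simp add: \<beta>)
  have vXY: "val X \<noteq> 1" "val Y \<noteq> 1"
    using Suc.prems(1)[of k] Suc.prems(2)[of k] O(1) by (simp_all add: X_def Y_def del: power_Suc)
  have nz: "1 - X \<noteq> 0" "1 - Y \<noteq> 0" "\<beta> - Y \<noteq> 0"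
    using vXY v\<beta> OXY by auto
  define L where "L = wp_log_deriv q k"
  define e where "e = (X * Y - 1) / ((1 - X) * (1 - Y))"
  define r where "r = (1 - X) / (1 - Y)"
  have Oe: "e \<in> R" "r \<in> R" using OXY vXY by (auto simp: e_def r_def)
  have OL: "L \<in> R" unfolding L_def
    by (rule lcongD(1)[where p = 0], rule lcong_log_deriv[of _ q q]) (use O Suc.prems in auto)
  have Ow: "wp 1 q k \<in> R" by (rule wp_closed) (use O Suc.prems(2) in \<open>auto simp: eq_commute[of 1]\<close>)
  \<comment> \<open>An exact expansion: over the common denominator the deviation from r is a
    multiple of ph.\<close>
  have 1: "(1 - \<beta> * X) / (\<beta> - Y) = r + p * h * ((X * Y - 1) / ((\<beta> - Y) * (1 - Y)))"
  proof -
    have "(1 - \<beta> * X) * (1 - Y) = (1 - X) * (\<beta> - Y) + p * h * (X * Y - 1)"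
      unfolding \<beta> by (simp add: algebra_simps)
    moreover have "(1 - \<beta> * X) / (\<beta> - Y) = ((1 - \<beta> * X) * (1 - Y)) / ((\<beta> - Y) * (1 - Y))"
      using nz by simp
    ultimately have "(1 - \<beta> * X) / (\<beta> - Y)
        = (1 - X) * (\<beta> - Y) / ((\<beta> - Y) * (1 - Y)) + p * h * (X * Y - 1) / ((\<beta> - Y) * (1 - Y))"
      by (simp only: add_divide_distrib)
    also have "(1 - X) * (\<beta> - Y) / ((\<beta> - Y) * (1 - Y)) = r" using nz by (simp add: r_def)
    finally show ?thesis by simp
  qed
  have 2: "r * (1 + p * h * e) = r + p * h * ((X * Y - 1) / ((1 - Y) * (1 - Y)))"
    using nz by (simp add: r_def e_def distrib_left)
  \<comment> \<open>Behind the factor ph, replacing \<beta> - Y by 1 - Y costs only a multiple of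
    p^2.\<close>
  have "lcong p \<beta> 1" using O by (intro lcongI[of _ _ h]) (auto simp: \<beta>)
  then have "lcong p ((X * Y - 1) / ((\<beta> - Y) * (1 - Y))) ((X * Y - 1) / ((1 - Y) * (1 - Y)))"
    using OXY vXY v\<beta> by (intro lcong_divide lcong_mult lcong_diff) auto
  from lcong_lift[OF this O(3,2)] have "lcong (p\<^sup>2) ((1 - \<beta> * X) / (\<beta> - Y)) (r * (1 + p * h * e))"
    unfolding 1 2 using Oe by (intro lcong_add) auto
  with Suc have "lcong (p\<^sup>2) (wp \<beta> q k * ((1 - \<beta> * X) / (\<beta> - Y)))
      (wp 1 q k * (1 + p * h * L) * (r * (1 + p * h * e)))"
    unfolding L_def by (intro lcong_mult) auto
  also have "lcong (p\<^sup>2) \<dots> (wp 1 q k * r * (1 + p * h * (L + e)))"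
  proof (rule lcongI[of _ _ "wp 1 q k * r * (h * h * L * e)"])
    show "wp 1 q k * (1 + p * h * L) * (r * (1 + p * h * e)) - wp 1 q k * r * (1 + p * h * (L + e))
       = p\<^sup>2 * (wp 1 q k * r * (h * h * L * e))"
      by (simp add: algebra_simps power2_eq_square)
  qed (use O Ow Oe OL in auto)
  also have "L + e = wp_log_deriv q (Suc k)"
    unfolding wp_log_deriv_def L_def e_def sum.lessThan_Suc XY X_def Y_def ..
  finally show ?case unfolding wp_Suc mult_1 X_def Y_def r_def .
qed

text \<open>First b = 1 is replaced by b = q^(-n) modulo p^2; then \<open>watson_at_b\<close>
  applies and its factor [n] leaves a comparison modulo p. The hypothesis 0 < M ensures that q does
  not take the value 1, so that [n] is regular.\<close>

lemma lcong_mod_root: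
  assumes O: "q \<in> R" "a \<in> R" "c \<in> R" "d \<in> R" "\<zeta> \<in> R" and n: "n = 4 * M + 1" and M: "0 < M"
    and p: "p = q - \<zeta>" "val q = val \<zeta>"
    and root: "primitive_root \<zeta> n" "primitive_root (val \<zeta>) n"
    and qi: "\<And>i. 0 < i \<Longrightarrow> q ^ i \<noteq> 1"
    and nz: "val a \<noteq> 0" "val c \<noteq> 0" "val d \<noteq> 0"
    and vc: "\<And>i. val c \<noteq> val q ^ i" and vd: "\<And>i. val d \<noteq> val q ^ i"
    and va: "\<And>i. val a \<noteq> val q ^ i" "\<And>i. val a * val q ^ i \<noteq> 1" "val a ^ n \<noteq> 1"
  defines "Q \<equiv> \<lambda>x. qpoch x (q ^ 4) M"
  shows "lcong (p\<^sup>2) (\<Sum>k\<le>M. vwp_term q [c, d, 1, a, 1 / a] k)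
     ((1 / q ^ M * qint q n * (Q (q\<^sup>2) / Q (q ^ 4))
       + 1 / q ^ M * qint q n * (h_fun n q a / ((1 - a)\<^sup>2 * (1 - a ^ n) * qpochs [q\<^sup>2, q ^ 4] (q ^ 4) M)))
      * phi_sum M q q (q\<^sup>2) c d (a * q) (q / a))"
proof -
  interpret \<zeta>: primitive_root_4M1 \<zeta> n M using root n by (auto simp: primitive_root_4M1_def primitive_root_4M1_axioms_def)
  interpret w: primitive_root_4M1 "val \<zeta>" n M using root n by (auto simp: primitive_root_4M1_def primitive_root_4M1_axioms_def)
  have pO: "p \<in> R" "val p = 0" using O p by auto
  have q\<zeta>: "lcong p q \<zeta>" using O by (intro lcongI[of _ _ 1]) (auto simp: p)
  have vq0: "val q \<noteq> 0" using w.z_nonzero p by simp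
  have vq: "val q ^ i \<noteq> 1" if "0 < i" "i < n" for i using w.power_neq_1[OF that] p by simp
  have vqn: "val q ^ n = 1" using w.root p by simp
  have v1: "val q \<noteq> 1" using vq[of 1] n M by simp
  have vqi: "val q ^ (4 * i + 1) \<noteq> 1" "val q ^ (4 * i + 2) \<noteq> 1" "val q ^ (4 * i + 3) \<noteq> 1" "val q ^ (4 * i + 4) \<noteq> 1" if "i < M" for i
    by (rule vq, use that n in simp, use that n in simp)+
  have nz': "q \<noteq> 0" "a \<noteq> 0" "c \<noteq> 0" "d \<noteq> 0" using nz vq0 by auto
  have ia: "1 / a \<in> R" "val (1 / a) = 1 / val a" using O nz by auto
  have via: "1 / val a \<noteq> val q ^ i" for i
    using va(2)[of i] nz(1) by (auto simp: divide_eq_eq mult.commute)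
  define xs where "xs = [c, d, a, 1 / a]"
  have vxs: "val x \<noteq> val q ^ (4 * i + 4)" if "x \<in> set xs" for x i
    using that vc[of "4 * i + 4"] vd[of "4 * i + 4"] va(1)[of "4 * i + 4"] via[of "4 * i + 4"] ia(2)
    by (auto simp: xs_def simp del: power_Suc)
  have xsO: "set xs \<subseteq> R" using O ia by (auto simp: xs_def)
  have vxs1: "val x \<noteq> val q ^ (4 * i + 4)" if "x \<in> set (xs @ [1])" "i < M" for x i
    using that vxs[of x i] vqi(4)[of i] by auto
  have xsO1: "set (xs @ [1]) \<subseteq> R" using xsO by auto
  have app: "vwp_term r (xs @ [x]) k = vwp_term r xs k * wp x r k" for r x k
    by (simp add: vwp_term_def mult_ac)

  have qn: "lcong p (q ^ n) 1" using lcong_power[OF q\<zeta>, of n] by (simp add: \<zeta>.root)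
  have qn': "lcong p (1 / q ^ n) 1"
    using lcong_divide[OF lcong_refl[OF one_closed] qn] O vqn by simp
  \<comment> \<open>q is congruent to an n-th root of unity, so q^(-n) = 1 + ph.\<close>
  obtain h where h: "h \<in> R" "1 / q ^ n - 1 = p * h" using qn' by (rule lcongE)
  define \<beta> where "\<beta> = 1 / q ^ n"
  have \<beta>: "\<beta> = 1 + p * h" using h(2) unfolding \<beta>_def by (simp add: algebra_simps)

  \<comment> \<open>The first-order coefficient at b = 1 may be computed at q = \<zeta>, where
    reflection makes it zero.\<close>
  have T: "lcong p (\<Sum>k\<le>M. vwp_term q (xs @ [1]) k * wp_log_deriv q k) 0"
  proof -
    have "lcong p (\<Sum>k\<le>M. vwp_term q (xs @ [1]) k * wp_log_deriv q k)
        (\<Sum>k\<le>M. vwp_term \<zeta> (xs @ [1]) k * wp_log_deriv \<zeta> k)"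
    proof (intro lcong_sum lcong_mult)
      fix k assume k: "k \<in> {..M}"
      have "list_all2 (lcong p) (xs @ [1]) (xs @ [1])" using O ia by (simp add: xs_def)
      then show "lcong p (vwp_term q (xs @ [1]) k) (vwp_term \<zeta> (xs @ [1]) k)"
        by (rule lcong_vwp_term[OF _ q\<zeta>]) (use k vxs1 vqi v1 in \<open>auto simp flip: p(2)\<close>)
      show "lcong p (wp_log_deriv q k) (wp_log_deriv \<zeta> k)"
        by (rule lcong_log_deriv[OF q\<zeta>]) (use k vqi in \<open>auto simp flip: p(2)\<close>)
    qed
    also have "(\<Sum>k\<le>M. vwp_term \<zeta> (xs @ [1]) k * wp_log_deriv \<zeta> k) = 0"
    proof (rule \<zeta>.sum_vwp_term_log_deriv)
      \<comment> \<open>The complex value of 2 shows that 2 is nonzero in the field.\<close>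
      have "val 2 = 2" using val_add[of 1 1] by simp
      then show "(2::'a) \<noteq> 0" by (metis val_zero zero_neq_numeral)
      show "x \<noteq> \<zeta> ^ (4 * i + 4)" if "x \<in> set (xs @ [1])" "i < M" for x i
        using vxs1[OF that] O(5) p(2) by (metis val_power)
    qed (simp add: xs_def)
    finally show ?thesis .
  qed

  have F: "lcong (p\<^sup>2) (\<Sum>k\<le>M. vwp_term q (xs @ [\<beta>]) k) (\<Sum>k\<le>M. vwp_term q (xs @ [1]) k)"
  proof -
    have "lcong (p\<^sup>2) (\<Sum>k\<le>M. vwp_term q (xs @ [\<beta>]) k)
        (\<Sum>k\<le>M. vwp_term q xs k * (wp 1 q k * (1 + p * h * wp_log_deriv q k)))"
      unfolding app
    proof (intro lcong_sum lcong_mult lcong_refl)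
      fix k assume k: "k \<in> {..M}"
      show "vwp_term q xs k \<in> R"
        by (rule vwp_term_closed) (use xsO O vxs v1 vqi k in auto)
      show "lcong (p\<^sup>2) (wp \<beta> q k) (wp 1 q k * (1 + p * h * wp_log_deriv q k))"
        by (rule lcong_wp_expand[OF O(1) pO(1) h(1) pO(2) \<beta>]) (use vqi k in auto)
    qed
    also have "(\<Sum>k\<le>M. vwp_term q xs k * (wp 1 q k * (1 + p * h * wp_log_deriv q k)))
       = (\<Sum>k\<le>M. vwp_term q (xs @ [1]) k) + p * h * (\<Sum>k\<le>M. vwp_term q (xs @ [1]) k * wp_log_deriv q k)"
      by (simp add: app sum_distrib_left distrib_left sum.distrib mult_ac)
    also have "lcong (p\<^sup>2) \<dots> ((\<Sum>k\<le>M. vwp_term q (xs @ [1]) k) + p * h * 0)"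
    proof (intro lcong_add lcong_lift[OF T h(1) pO(1)] lcong_refl sum_closed)
      fix k assume k: "k \<in> {..M}"
      show "vwp_term q (xs @ [1]) k \<in> R"
        by (rule vwp_term_closed) (use xsO1 O vxs1 v1 vqi k in auto)
    qed
    finally show ?thesis by simp
  qed

  have q4: "(val q ^ 4) ^ i = val q ^ (4 * i)" for i by (simp add: power_mult)
  have vQ: "qpoch (val q ^ j) (val q ^ 4) M \<noteq> 0" if "j \<in> {2, 4}" for j
  proof -
    have e: "val q ^ j * (val q ^ 4) ^ i = val q ^ (4 * i + j)" for i
      by (simp only: q4 power_add mult.commute)
    show ?thesis unfolding qpoch_eq_0_iff e using that vqi by auto
  qed
  have vQa: "qpoch (val q ^ 4 * val a) (val q ^ 4) M \<noteq> 0" "qpoch (val q ^ 4 / val a) (val q ^ 4) M \<noteq> 0"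
  proof -
    have e: "val q ^ 4 * val a * (val q ^ 4) ^ i = val a * val q ^ (4 * i + 4)"
      "val q ^ 4 / val a * (val q ^ 4) ^ i = val q ^ (4 * i + 4) / val a" for i
      by (simp_all add: q4 power_add mult_ac)
    show "qpoch (val q ^ 4 * val a) (val q ^ 4) M \<noteq> 0" unfolding qpoch_eq_0_iff e using va(2) by blast
    show "qpoch (val q ^ 4 / val a) (val q ^ 4) M \<noteq> 0"
      unfolding qpoch_eq_0_iff e using va(1)[THEN not_sym] nz(1) by (auto simp del: power_Suc)
  qed
  define D where "D = (\<lambda>r. (1 - a)\<^sup>2 * (1 - a ^ n) * qpochs [r\<^sup>2, r ^ 4] (r ^ 4) M)"
  define B where "B = (\<lambda>r. 1 / r ^ M * (qpoch (r\<^sup>2) (r ^ 4) M / qpoch (r ^ 4) (r ^ 4) M + h_fun n r a / D r))"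
  define A where "A = (\<lambda>r. qpoch r (r ^ 4) M * qpoch (r ^ 3) (r ^ 4) M
         / (qpoch (r ^ 4 * a) (r ^ 4) M * qpoch (r ^ 4 / a) (r ^ 4) M))"
  have va1: "val a \<noteq> 1" using va(1)[of 0] by simp
  \<comment> \<open>A and B are the prefactors from Watson's transformation and from the theorem,
    both without [n]; they coincide at \<zeta>.\<close>
  have AB: "A \<zeta> = B \<zeta>"
  proof -
    have "a ^ n \<noteq> 1" using va(3) O(2) by (metis val_one val_power)
    from \<zeta>.prefactor_eq[OF nz'(2) this] show ?thesis by (simp only: A_def B_def D_def)
  qed
  have Acong: "lcong p (A q) (A \<zeta>)"
    unfolding A_def
    by (intro lcong_divide lcong_mult lcong_qpoch lcong_power q\<zeta> lcong_refl O(2))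
      (use O vQa nz in \<open>simp_all flip: p(2)\<close>)
  have hcong: "lcong p (h_fun n q a) (h_fun n \<zeta> a)"
    unfolding h_fun_def qpochs_Cons qpochs_Nil
    by (intro lcong_divide lcong_mult lcong_diff lcong_qpoch lcong_power q\<zeta>)
      (use O nz in simp_all)
  have vD: "val (D q) \<noteq> 0" "val (D \<zeta>) \<noteq> 0" "D q \<in> R"
    using O va(3) va1 vQ[of 2] vQ[of 4] by (auto simp: D_def simp flip: p(2))
  have Dcong: "lcong p (D q) (D \<zeta>)"
    unfolding D_def qpochs_Cons qpochs_Nil
    by (intro lcong_mult lcong_diff lcong_qpoch lcong_power q\<zeta>) (use O in simp_all)
  have Bcong: "lcong p (B q) (B \<zeta>)"
    unfolding B_def
    by (intro lcong_mult lcong_add lcong_divide[OF hcong Dcong vD(1,2)] lcong_divide lcong_qpoch lcong_power q\<zeta> lcong_refl)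
      (use O vQ[of 2] vQ[of 4] vq0 in \<open>simp_all flip: p(2)\<close>)
  have ABcong: "lcong p (A q) (B q)" using lcong_trans[OF Acong] lcong_sym[OF Bcong] unfolding AB .

  have v2: "val (q\<^sup>2) * val q ^ (4 * i) \<noteq> 1" "val (q\<^sup>2 / q ^ n) * val q ^ (4 * i) \<noteq> 1" if "i < M" for i
  proof -
    have "val (q\<^sup>2) * val q ^ (4 * i) = val q ^ (4 * i + 2)"
      using O(1) by (simp only: val_power power_add mult.commute)
    moreover have "val (q\<^sup>2 / q ^ n) = val (q\<^sup>2)" using O vqn by simp
    ultimately show "val (q\<^sup>2) * val q ^ (4 * i) \<noteq> 1" "val (q\<^sup>2 / q ^ n) * val q ^ (4 * i) \<noteq> 1"
      using vqi(2)[OF that] by (simp_all only: not_False_eq_True)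
  qed
  have qdiv: "lcong p (x / q ^ n) x" if "x \<in> R" for x
    using lcong_mult[OF lcong_refl[OF that] qn'] by simp
  have \<Phi>: "lcong p (phi_sum M q (q / q ^ n) (q\<^sup>2 / q ^ n) c d (a * q) (q / a))
      (phi_sum M q q (q\<^sup>2) c d (a * q) (q / a))"
  proof (rule lcong_phi_sum[OF qdiv qdiv lcong_refl lcong_refl])
    show "a * q \<in> R" "q / a \<in> R" "q\<^sup>2 \<in> R" using O nz by auto
  qed (use O nz vc vd vqi v2 in auto)
  \<comment> \<open>[n] vanishes at \<zeta> and supplies one factor p, so its cofactors need to
    agree modulo p only.\<close>
  have "lcong p (qint q n) (qint \<zeta> n)" using q\<zeta> v1 p(2) by (intro lcong_qint) auto
  also have "qint \<zeta> n = 0" by (simp add: qint_def \<zeta>.root)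
  finally obtain g where g: "g \<in> R" "qint q n - 0 = p * g" by (rule lcongE)
  have "lcong (p\<^sup>2) (p * g * (A q * phi_sum M q (q / q ^ n) (q\<^sup>2 / q ^ n) c d (a * q) (q / a)))
     (p * g * (B q * phi_sum M q q (q\<^sup>2) c d (a * q) (q / a)))"
    by (rule lcong_lift[OF lcong_mult[OF ABcong \<Phi>] g(1) pO(1)])
  then have W: "lcong (p\<^sup>2) (qint q n * (A q * phi_sum M q (q / q ^ n) (q\<^sup>2 / q ^ n) c d (a * q) (q / a)))
     (qint q n * (B q * phi_sum M q q (q\<^sup>2) c d (a * q) (q / a)))"
    unfolding g(2)[symmetric] by simp
  have ci: "c \<noteq> q ^ i" for i using vc[of i] O(1) by (metis val_power)
  have di: "d \<noteq> q ^ i" for i using vd[of i] O(1) by (metis val_power)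
  have ai: "a \<noteq> q ^ i" "a * q ^ i \<noteq> 1" for i
    using va(1)[of i] va(2)[of i] O by (metis val_power, metis val_power val_mult val_one power_closed)
  have wat: "(\<Sum>k\<le>M. vwp_term q (xs @ [\<beta>]) k)
     = qint q n * (A q * phi_sum M q (q / q ^ n) (q\<^sup>2 / q ^ n) c d (a * q) (q / a))"
    unfolding A_def phi_sum_def xs_def \<beta>_def append.simps
    by (rule watson_at_b[OF nz'(1) qi n nz'(2,3,4) ci di ai])
  have "(\<Sum>k\<le>M. vwp_term q [c, d, 1, a, 1 / a] k) = (\<Sum>k\<le>M. vwp_term q (xs @ [1]) k)"
    by (simp add: xs_def vwp_term_def mult_ac)
  also have "lcong (p\<^sup>2) \<dots> (qint q n * (A q * phi_sum M q (q / q ^ n) (q\<^sup>2 / q ^ n) c d (a * q) (q / a)))"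
    using lcong_sym[OF F] unfolding wat .
  also note W
  also have "qint q n * (B q * phi_sum M q q (q\<^sup>2) c d (a * q) (q / a))
     = (1 / q ^ M * qint q n * (Q (q\<^sup>2) / Q (q ^ 4))
       + 1 / q ^ M * qint q n * (h_fun n q a / D q)) * phi_sum M q q (q\<^sup>2) c d (a * q) (q / a)"
    by (simp only: B_def Q_def distrib_left mult_ac)
  finally show ?thesis unfolding D_def .
qed

end

section \<open>Rational functions near a point\<close>

text \<open>The outermost indeterminate d is substituted first; each value enters as a constant
  polynomial in the indeterminates still present.\<close>

definition peval :: "complex \<Rightarrow> complex \<Rightarrow> complex \<Rightarrow> complex \<Rightarrow> poly_qacd \<Rightarrow> complex" where
  "peval q a c d P = poly (poly (poly (poly P [:[:[:d:]:]:]) [:[:c:]:]) [:a:]) q"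

lemma peval_simps [simp]:
  "peval q a c d 0 = 0" "peval q a c d 1 = 1"
  "peval q a c d (P + P') = peval q a c d P + peval q a c d P'"
  "peval q a c d (P - P') = peval q a c d P - peval q a c d P'"
  "peval q a c d (- P) = - peval q a c d P"
  "peval q a c d (P * P') = peval q a c d P * peval q a c d P'"
  "peval q a c d (P ^ k) = peval q a c d P ^ k"
  "peval q a c d (embed_q p) = poly p q"
  "peval q a c d var_q = q" "peval q a c d var_a = a" "peval q a c d var_c = c" "peval q a c d var_d = d"
  by (simp_all add: peval_def embed_q_def var_q_def var_a_def var_c_def var_d_def)

definition regular_at :: "(poly_qacd \<Rightarrow> complex) \<Rightarrow> ratfun_qacd set" where
  "regular_at ev = {x. ev (snd (quot_of_fract x)) \<noteq> 0}"

text \<open>Outside \<open>regular_at ev\<close> the division by zero gives the default value 0; the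
  laws of \<open>local_subring\<close> concern regular elements only.\<close>

definition fract_eval :: "(poly_qacd \<Rightarrow> complex) \<Rightarrow> ratfun_qacd \<Rightarrow> complex" where
  "fract_eval ev x = ev (fst (quot_of_fract x)) / ev (snd (quot_of_fract x))"

lemma to_fract_power: "to_fract (x ^ k) = to_fract x ^ k"
  by (induction k) simp_all

lemma quot_of_fract_eq:
  "x = to_fract (fst (quot_of_fract x)) / to_fract (snd (quot_of_fract x))"
  by (simp flip: Fract_conv_to_fract)

text \<open>Cross-multiplication, followed by coprimality of the reduced numerator and
  denominator.\<close>

lemma snd_quot_of_fract_dvd:
  assumes "D \<noteq> 0" "x = to_fract N / to_fract D"
  shows "fst (quot_of_fract x) * D = N * snd (quot_of_fract x)" "snd (quot_of_fract x) dvd D"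
proof -
  let ?u = "fst (quot_of_fract x)" and ?v = "snd (quot_of_fract x)"
  have "to_fract ?u / to_fract ?v = to_fract N / to_fract D"
    using quot_of_fract_eq[of x] assms(2) by simp
  then have "to_fract (?u * D) = to_fract (N * ?v)" using assms(1) by (simp add: frac_eq_eq)
  then show eq: "?u * D = N * ?v" by (simp only: to_fract_eq_iff)
  have "coprime ?v ?u" using coprime_quot_of_fract[of x] by (simp add: coprime_commute)
  then show "?v dvd D" using eq by (metis coprime_dvd_mult_right_iff dvd_triv_right)
qed

text \<open>Frees the congruence from lowest terms: reducing the fraction cannot cancel any part of
  P, because D is coprime to P.\<close>

lemma fract_cong_by_representation:
  assumes "x - y = to_fract (P * N) / to_fract D" "D \<noteq> 0" "coprime D P"
  shows "fract_cong x y P"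
proof -
  note * = snd_quot_of_fract_dvd[OF assms(2,1)]
  have "P dvd fst (quot_of_fract (x - y)) * D" unfolding *(1) by simp
  then have "P dvd fst (quot_of_fract (x - y))"
    using assms(3) by (simp add: coprime_dvd_mult_left_iff coprime_commute)
  moreover have "coprime (snd (quot_of_fract (x - y))) P"
    using *(2) assms(3) by (metis coprime_divisors dvd_refl)
  ultimately show ?thesis by (simp add: fract_cong_def)
qed

lemma fract_cong_mult_modulus:
  assumes "fract_cong x y P" "fract_cong x y P'" "coprime P P'"
  shows "fract_cong x y (P * P')"
  using assms by (auto simp: fract_cong_def intro: divides_mult)

lemma fract_cong_prod_modulus:
  assumes "finite A" "\<And>i. i \<in> A \<Longrightarrow> fract_cong x y (P i)"
    "\<And>i j. i \<in> A \<Longrightarrow> j \<in> A \<Longrightarrow> i \<noteq> j \<Longrightarrow> coprime (P i) (P j)"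
  shows "fract_cong x y (prod P A)"
  using assms
proof (induction A rule: finite_induct)
  case empty
  then show ?case by (simp add: fract_cong_def)
next
  case (insert i A)
  have "coprime (P i) (prod P A)"
    by (rule prod_coprime_right) (use insert in auto)
  then show ?case using insert by (auto intro!: fract_cong_mult_modulus)
qed

section \<open>The local ring of a point\<close>

locale point =
  fixes ev :: "poly_qacd \<Rightarrow> complex"
  assumes ev_hom: "ev 1 = 1" "\<And>P P'. ev (P + P') = ev P + ev P'" "\<And>P P'. ev (P * P') = ev P * ev P'"
begin

lemma ev_uminus: "ev (- P) = - ev P"
proof -
  have "ev 0 = 0" using ev_hom(2)[of 0 0] by simp
  then show ?thesis using ev_hom(2)[of P "- P"] by (simp add: eq_neg_iff_add_eq_0 add.commute)
qed

lemma ev_nonzeroD: "ev D \<noteq> 0 \<Longrightarrow> D \<noteq> 0"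
  using ev_hom(2)[of 0 0] by auto

lemma regular_atI:
  assumes "ev D \<noteq> 0" "x = to_fract N / to_fract D"
  shows "x \<in> regular_at ev" "fract_eval ev x = ev N / ev D"
proof -
  note * = snd_quot_of_fract_dvd[OF ev_nonzeroD[OF assms(1)] assms(2)]
  show r: "x \<in> regular_at ev" using *(2) assms(1) by (auto simp: regular_at_def ev_hom)
  have "ev (fst (quot_of_fract x)) * ev D = ev N * ev (snd (quot_of_fract x))"
    using arg_cong[OF *(1), of ev] by (simp add: ev_hom)
  then show "fract_eval ev x = ev N / ev D"
    using r assms(1) by (simp add: fract_eval_def regular_at_def frac_eq_eq)
qed

lemma regular_atE:
  assumes "x \<in> regular_at ev"
  obtains N D where "ev D \<noteq> 0" "D \<noteq> 0" "x = to_fract N / to_fract D" "fract_eval ev x = ev N / ev D"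
  using assms quot_of_fract_eq[of x] by (auto simp: regular_at_def fract_eval_def)

lemma to_fract_regular [simp]: "to_fract N \<in> regular_at ev" "fract_eval ev (to_fract N) = ev N"
  using regular_atI[of 1 "to_fract N" N] by (simp_all add: ev_hom)

sublocale local_subring "regular_at ev" "fract_eval ev"
proof
  show "1 \<in> regular_at ev" "fract_eval ev 1 = 1"
    using to_fract_regular[of 1] by (simp_all add: ev_hom)
next
  fix x y assume xy: "x \<in> regular_at ev" "y \<in> regular_at ev"
  obtain N D where x: "ev D \<noteq> 0" "D \<noteq> 0" "x = to_fract N / to_fract D" "fract_eval ev x = ev N / ev D"
    using xy(1) by (rule regular_atE)
  obtain N' D' where y: "ev D' \<noteq> 0" "D' \<noteq> 0" "y = to_fract N' / to_fract D'" "fract_eval ev y = ev N' / ev D'"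
    using xy(2) by (rule regular_atE)
  have D: "ev (D * D') \<noteq> 0" using x y by (simp add: ev_hom)
  have "x + y = to_fract (N * D' + N' * D) / to_fract (D * D')"
    using x y by (simp add: add_frac_eq)
  from regular_atI[OF D this] show "x + y \<in> regular_at ev" "fract_eval ev (x + y) = fract_eval ev x + fract_eval ev y"
    using x y by (simp_all add: ev_hom add_frac_eq)
  have "x * y = to_fract (N * N') / to_fract (D * D')" using x y by simp
  from regular_atI[OF D this] show "x * y \<in> regular_at ev" "fract_eval ev (x * y) = fract_eval ev x * fract_eval ev y"
    using x y by (simp_all add: ev_hom)
next
  fix x assume "x \<in> regular_at ev"
  then obtain N D where x: "ev D \<noteq> 0" "D \<noteq> 0" "x = to_fract N / to_fract D" "fract_eval ev x = ev N / ev D"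
    by (rule regular_atE)
  have "- x = to_fract (- N) / to_fract D" using x by simp
  from regular_atI[OF x(1) this] show "- x \<in> regular_at ev" "fract_eval ev (- x) = - fract_eval ev x"
    using x by (simp_all add: ev_uminus)
  assume "fract_eval ev x \<noteq> 0"
  then have "ev N \<noteq> 0" using x by auto
  moreover have "inverse x = to_fract D / to_fract N" using x by simp
  ultimately show "inverse x \<in> regular_at ev" by (rule regular_atI)
qed

text \<open>One complex value certifies coprimality: a multiple of P would vanish at the
  point.\<close>

lemma coprime_at:
  assumes "prime_elem P" "ev P = 0" "ev D \<noteq> 0"
  shows "coprime P D"
proof -
  have "\<not> P dvd D" using assms by (auto simp: ev_hom)
  with assms(1) show ?thesis by (rule prime_elem_imp_coprime)
qed

text \<open>Passage from the local ring to the congruence of the theorem: a denominator that is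
  nonzero at a zero of the prime P is coprime to every power of P.\<close>

lemma lcong_imp_fract_cong:
  assumes "lcong (to_fract P ^ k) x y" "prime_elem P" "ev P = 0"
  shows "fract_cong x y (P ^ k)"
proof -
  obtain w where w: "w \<in> regular_at ev" "x - y = to_fract P ^ k * w" using assms(1) by (rule lcongE)
  obtain N D where D: "ev D \<noteq> 0" "D \<noteq> 0" "w = to_fract N / to_fract D" using w(1) by (rule regular_atE)
  have "x - y = to_fract (P ^ k * N) / to_fract D" using w(2) D by (simp add: to_fract_power)
  moreover have "coprime D (P ^ k)"
    using coprime_at[OF assms(2,3) D(1)] by (simp add: coprime_commute)
  ultimately show ?thesis using D(2) by (intro fract_cong_by_representation) auto
qed

end

lemma point_peval: "point (peval q a c d)"
  by standard simp_all

section \<open>The prime factors of the modulus\<close>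

lemma embed_q_mult: "embed_q (p * p') = embed_q p * embed_q p'"
  by (simp add: embed_q_def)

lemma embed_q_1: "embed_q 1 = 1"
  by (simp add: embed_q_def one_pCons)

lemma embed_q_prod: "embed_q (prod f A) = (\<Prod>i\<in>A. embed_q (f i))"
  by (induction A rule: infinite_finite_induct) (simp_all add: embed_q_mult embed_q_1)

lemma prime_elem_embed_q_linear: "prime_elem (embed_q [:- z, 1:])"
  by (simp add: embed_q_def prime_elem_const_poly_iff prime_elem_linear_field_poly)

lemma const_poly_power: "[:x:] ^ k = [:x ^ k:]"
  by (induction k) (simp_all add: one_pCons mult_ac)

text \<open>Linear in a over the polynomials in q with coprime coefficients, and constant in c and
  d.\<close>

lemma prime_elem_a_minus_power: "prime_elem (var_a - var_q ^ n)"
proof -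
  have "var_a - var_q ^ n = [:[:[:- ([:0, 1:] ^ n), 1:]:]:]"
    by (simp add: var_a_def var_q_def const_poly_power)
  moreover have "prime_elem [:- ([:0, 1:] ^ n), 1 :: complex poly:]"
    by (rule prime_elem_linear_poly) auto
  ultimately show ?thesis by (simp add: prime_elem_const_poly_iff)
qed

lemma prime_elem_one_minus_a_power: "prime_elem (1 - var_a * var_q ^ n)"
proof -
  have "1 - var_a * var_q ^ n = [:[:[:1, - ([:0, 1:] ^ n):]:]:]"
    by (simp add: var_a_def var_q_def const_poly_power one_pCons)
  moreover have "prime_elem [:1 :: complex poly, - ([:0, 1:] ^ n):]"
    by (rule prime_elem_linear_poly) auto
  ultimately show ?thesis by (simp add: prime_elem_const_poly_iff)
qed

text \<open>If the i-th power is 1, the angle 2 pi k i / n is a multiple of 2 pi, so n divides k i,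
  and k is coprime to n.\<close>

lemma primitive_root_cis:
  assumes "0 < n" "coprime k n"
  shows "primitive_root (cis (2 * pi * real k / real n)) n"
proof
  have pow: "cis (2 * pi * real k / real n) ^ i = cis (2 * pi * real (k * i) / real n)" for i
    by (simp add: Complex.DeMoivre mult_ac)
  have "2 * pi * real (k * n) / real n = 2 * pi * of_int (int k)" using assms by simp
  then show "cis (2 * pi * real k / real n) ^ n = 1" unfolding pow by (simp only: cis_multiple_2pi Ints_of_int)
  show "n dvd i" if "cis (2 * pi * real k / real n) ^ i = 1" for i
  proof -
    have "cos (2 * pi * real (k * i) / real n) = 1"
      using that unfolding pow by (simp add: complex_eq_iff)
    then obtain m :: int where "2 * pi * real (k * i) / real n = of_int m * 2 * pi"
      unfolding cos_one_2pi_int by auto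
    then have "real (k * i) = of_int m * real n" using assms(1) by (simp add: field_simps)
    then have "of_int (int (k * i)) = (of_int (m * int n) :: real)" by simp
    then have "int (k * i) = m * int n" by (simp only: of_int_eq_iff)
    then have "n dvd k * i" by (metis dvd_triv_right int_dvd_int_iff)
    then show ?thesis using assms(2) by (simp add: coprime_dvd_mult_right_iff coprime_commute)
  qed
qed (rule assms)

section \<open>Assembly over the factors of the modulus\<close>

theorem theorem4:
  fixes n :: nat and q a c d :: ratfun_qacd
  assumes "n > 0" and "[n = 1] (mod 4)"
  defines "q \<equiv> to_fract var_q" and "a \<equiv> to_fract var_a"
    and "c \<equiv> to_fract var_c" and "d \<equiv> to_fract var_d"
  shows "fract_cong
    (\<Sum>k = 0..(n - 1) div 4.
       qint q (8 * k + 1)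
       * ((qpoch q (q^4) k)^2 * qpochs [c * q, d * q, q * a, q / a] (q^4) k
          / ((qpoch (q^4) (q^4) k)^2 * qpochs [q^4 / c, q^4 / d, q^4 * a, q^4 / a] (q^4) k))
       * (c * d) powi (- int k) * q ^ (5 * k))
    ((q powi ((1 - int n) div 4) * qint q n
        * (qpoch (q^2) (q^4) ((n - 1) div 4) / qpoch (q^4) (q^4) ((n - 1) div 4))
      + q powi ((1 - int n) div 4) * qint q n
        * (h_fun n q a
           / ((1 - a)^2 * (1 - a ^ n) * qpochs [q^2, q^4] (q^4) ((n - 1) div 4))))
     * (\<Sum>k = 0..(n - 1) div 4.
          qpochs [q, q^3 / (c * d), a * q, q / a] (q^4) k
          / qpochs [q^2, q^4, q^4 / c, q^4 / d] (q^4) k * q ^ (4 * k)))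
    ((embed_q (cyclotomic n))^2 * (var_a - var_q ^ n) * (1 - var_a * var_q ^ n))"
    (is "fract_cong ?L ?R _")
proof -
  define M where "M = (n - 1) div 4"
  have n: "n = 4 * M + 1"
    using assms(1,2) unfolding M_def cong_def by presburger
  have M: "(n - 1) div 4 = M" "(1 - int n) div 4 = - int M" by (simp_all add: n)
  have nz: "q \<noteq> 0" "a \<noteq> 0" "c \<noteq> 0" "d \<noteq> 0"
    by (simp_all add: q_def a_def c_def d_def var_q_def var_a_def var_c_def var_d_def)
  have L: "?L = (\<Sum>k\<le>M. vwp_term q [c, d, 1, a, 1 / a] k)"
    unfolding M atLeast0AtMost
  proof (rule sum.cong[OF refl])
    fix k
    have ia: "1 / a \<noteq> 0" using nz by simp
    have cd: "(c * d) powi (- int k) = 1 / (c ^ k * d ^ k)"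
      by (simp add: power_int_minus power_mult_distrib divide_inverse)
    \<comment> \<open>The powers absorbed by \<open>wp\<close> for the parameters a and 1/a cancel,
      leaving only (cd)^(-k).\<close>
    have ak: "a ^ k * (1 / a) ^ k = 1" using nz by (simp flip: power_mult_distrib)
    have as: "q ^ 4 / (1 / a) = q ^ 4 * a" "1 / a * q = q / a" by simp_all
    define X where "X = qint q (8 * k + 1) * (qpoch q (q^4) k)^2 * (qpoch (c * q) (q^4) k
        * qpoch (d * q) (q^4) k * qpoch (a * q) (q^4) k * qpoch (q / a) (q^4) k)
        / ((qpoch (q^4) (q^4) k)^2 * (qpoch (q^4 / c) (q^4) k * qpoch (q^4 / d) (q^4) k
           * qpoch (q^4 * a) (q^4) k * qpoch (q^4 / a) (q^4) k)) / (c ^ k * d ^ k) * q ^ (5 * k)"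
    have "vwp_term q [c, d, 1, a, 1 / a] k = X / (a ^ k * (1 / a) ^ k)"
      unfolding vwp_term_def list.map prod_list.Cons prod_list.Nil wp_conv_qpoch[OF nz(2)] wp_conv_qpoch[OF nz(3)]
        wp_conv_qpoch[OF nz(4)] wp_conv_qpoch[OF ia] wp_conv_qpoch[OF one_neq_zero] as X_def
      by (simp add: power2_eq_square mult_ac)
    then have 1: "vwp_term q [c, d, 1, a, 1 / a] k = X" unfolding ak by simp
    show "qint q (8 * k + 1)
       * ((qpoch q (q^4) k)^2 * qpochs [c * q, d * q, q * a, q / a] (q^4) k
          / ((qpoch (q^4) (q^4) k)^2 * qpochs [q^4 / c, q^4 / d, q^4 * a, q^4 / a] (q^4) k))
       * (c * d) powi (- int k) * q ^ (5 * k) = vwp_term q [c, d, 1, a, 1 / a] k"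
      unfolding 1 cd X_def qpochs_Cons qpochs_Nil by (simp add: mult_ac)
  qed
  have qM: "q powi ((1 - int n) div 4) = 1 / q ^ M"
    unfolding M by (simp add: power_int_minus divide_inverse)
  have R: "?R = (1 / q ^ M * qint q n * (qpoch (q\<^sup>2) (q ^ 4) M / qpoch (q ^ 4) (q ^ 4) M)
       + 1 / q ^ M * qint q n * (h_fun n q a / ((1 - a)\<^sup>2 * (1 - a ^ n) * qpochs [q\<^sup>2, q ^ 4] (q ^ 4) M)))
      * phi_sum M q q (q\<^sup>2) c d (a * q) (q / a)"
    unfolding qM unfolding M atLeast0AtMost phi_sum_def ..
  have two: "(2::complex) ^ i \<noteq> 1" if "0 < i" for i
  proof
    assume "(2::complex) ^ i = 1"
    then have "norm ((2::complex) ^ i) = 1" by simp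
    then have "(2::real) ^ i = 1" by (simp add: norm_power)
    with one_less_power[of "2::real" i] that show False by simp
  qed
  have neg: "(- 1::complex) \<noteq> 2 ^ i" for i
  proof
    assume *: "(- 1::complex) = 2 ^ i"
    have "(of_nat (2 ^ i + 1) :: complex) = 2 ^ i + 1" by simp
    also have "\<dots> = 0" unfolding *[symmetric] by simp
    finally have "(of_nat (2 ^ i + 1) :: complex) = 0" .
    then show False by (simp only: of_nat_eq_0_iff)
  qed
  have A1: "fract_cong ?L ?R (var_a - var_q ^ n)"
  proof -
    \<comment> \<open>A point on a = q^n: 2 is not a root of unity, and c = d = -1 is no power of 2,
      so all denominators survive.\<close>
    interpret point "peval 2 (2 ^ n) (- 1) (- 1)" by (rule point_peval)
    have p: "to_fract (var_a - var_q ^ n) = a - q ^ n"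
      by (simp add: a_def q_def to_fract_power)
    have "lcong (to_fract (var_a - var_q ^ n)) ?L ?R"
      unfolding L R
    proof (rule lcong_mod_a)
      show "n = 4 * M + 1" by (rule n)
      show "lcong (to_fract (var_a - var_q ^ n)) a (q ^ n) \<or> lcong (to_fract (var_a - var_q ^ n)) a (1 / q ^ n)"
        unfolding p by (rule disjI1, rule lcongI[of _ _ 1]) (simp_all add: a_def q_def)
    qed (use two neg in \<open>simp_all add: q_def a_def c_def d_def\<close>)
    then show ?thesis
      using lcong_imp_fract_cong[of "var_a - var_q ^ n" 1] prime_elem_a_minus_power by simp
  qed
  have A2: "fract_cong ?L ?R (1 - var_a * var_q ^ n)"
  proof -
    \<comment> \<open>The corresponding point on a q^n = 1.\<close>
    interpret point "peval 2 (1 / 2 ^ n) (- 1) (- 1)" by (rule point_peval)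
    have p: "to_fract (1 - var_a * var_q ^ n) = 1 - a * q ^ n"
      by (simp add: a_def q_def to_fract_power)
    have iq: "1 / q ^ n \<in> regular_at (peval 2 (1 / 2 ^ n) (- 1) (- 1))" by (simp add: q_def)
    have "lcong (to_fract (1 - var_a * var_q ^ n)) ?L ?R"
      unfolding L R
    proof (rule lcong_mod_a)
      show "n = 4 * M + 1" by (rule n)
      show "lcong (to_fract (1 - var_a * var_q ^ n)) a (q ^ n) \<or> lcong (to_fract (1 - var_a * var_q ^ n)) a (1 / q ^ n)"
        unfolding p
      proof (rule disjI2, rule lcongI[of _ _ "- (1 / q ^ n)"])
        show "a - 1 / q ^ n = (1 - a * q ^ n) * - (1 / q ^ n)" using nz by (simp add: field_simps)
      qed (use iq in \<open>simp_all add: a_def\<close>)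
    qed (use two neg in \<open>simp_all add: q_def a_def c_def d_def\<close>)
    then show ?thesis
      using lcong_imp_fract_cong[of "1 - var_a * var_q ^ n" 1] prime_elem_one_minus_a_power by simp
  qed
  have A3: "fract_cong ?L ?R (embed_q [:- \<zeta>, 1:] ^ 2)" if root: "primitive_root \<zeta> n" and M0: "0 < M" for \<zeta>
  proof -
    \<comment> \<open>A point on q = \<zeta>: the powers of \<zeta> have modulus 1, which keeps the
      value 2 of a, c and d away from them.\<close>
    interpret point "peval \<zeta> 2 2 2" by (rule point_peval)
    interpret \<zeta>: primitive_root \<zeta> n by (rule root)
    \<comment> \<open>The root \<zeta> as a constant rational function, so that p = q - Z lies in
      the field.\<close>
    define Z where "Z = to_fract (embed_q [:\<zeta>:])"
    have Z: "Z \<in> regular_at (peval \<zeta> 2 2 2)" "fract_eval (peval \<zeta> 2 2 2) Z = \<zeta>" by (simp_all add: Z_def)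
    have Zpow: "Z ^ i = to_fract (embed_q [:\<zeta> ^ i:])" for i
      by (simp add: Z_def embed_q_def const_poly_power flip: to_fract_power)
    have "norm \<zeta> ^ n = 1" using \<zeta>.root by (metis norm_one norm_power)
    then have norm: "norm \<zeta> = 1" using power_eq_iff_eq_base[of n "norm \<zeta>" 1] \<zeta>.n_pos by simp
    have two_\<zeta>: "2 \<noteq> \<zeta> ^ i" "2 * \<zeta> ^ i \<noteq> 1" for i
    proof -
      have "norm (\<zeta> ^ i) = 1" using norm by (simp add: norm_power)
      then show "2 \<noteq> \<zeta> ^ i" by auto
      have "norm (2 * \<zeta> ^ i) = 2" using norm by (simp add: norm_mult norm_power)
      then show "2 * \<zeta> ^ i \<noteq> 1" by (metis norm_one numeral_eq_one_iff semiring_norm(85))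
    qed
    have p: "to_fract (embed_q [:- \<zeta>, 1:]) = q - Z"
      by (simp add: q_def Z_def var_q_def embed_q_def flip: to_fract_diff)
    have rootZ: "primitive_root Z n"
    proof
      show "Z ^ n = 1" unfolding Zpow \<zeta>.root by (simp add: embed_q_1 flip: one_pCons)
      show "n dvd i" if "Z ^ i = 1" for i
      proof -
        have "\<zeta> ^ i = 1" using arg_cong[OF that, of "fract_eval (peval \<zeta> 2 2 2)"] Z by simp
        then show ?thesis by (rule \<zeta>.primitive)
      qed
    qed (rule \<zeta>.n_pos)
    have qi: "q ^ i \<noteq> 1" if "0 < i" for i
    proof
      assume "q ^ i = 1"
      then have "to_fract (var_q ^ i) = to_fract 1" by (simp add: q_def to_fract_power)
      then have "var_q ^ i = 1" by (simp only: to_fract_eq_iff)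
      then have "peval 2 2 2 2 (var_q ^ i) = 1" by simp
      with two[OF that] show False by simp
    qed
    have "lcong (to_fract (embed_q [:- \<zeta>, 1:]) ^ 2) ?L ?R"
      unfolding L R
    proof (rule lcong_mod_root[where \<zeta> = Z])
      show "n = 4 * M + 1" "0 < M" "to_fract (embed_q [:- \<zeta>, 1:]) = q - Z" "primitive_root Z n" by fact+
      show "primitive_root (fract_eval (peval \<zeta> 2 2 2) Z) n" using Z root by simp
      show "q ^ i \<noteq> 1" if "0 < i" for i using that by (rule qi)
    qed (use Z two_\<zeta> two \<zeta>.n_pos in \<open>simp_all add: q_def a_def c_def d_def\<close>)
    then show ?thesis
      using lcong_imp_fract_cong[of "embed_q [:- \<zeta>, 1:]" 2] prime_elem_embed_q_linear by simp
  qed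
  show ?thesis
  proof (cases "M = 0")
    case True
    have "a \<noteq> 1"
      by (simp add: a_def var_a_def one_pCons flip: to_fract_1)
    \<comment> \<open>For n = 1 only k = 0 remains and the braces in h cancel, so the two sides are
      equal.\<close>
    then have "?L = ?R"
      unfolding L R using True n nz
      by (simp add: vwp_term_def phi_sum_def qint_def h_fun_def)
    then show ?thesis by (simp add: fract_cong_def)
  next
    case False
    define S where "S = {k\<in>{1..n}. coprime k n}"
    define \<zeta> where "\<zeta> = (\<lambda>k. cis (2 * pi * real k / real n))"
    have root: "primitive_root (\<zeta> k) n" if "k \<in> S" for k
      using that assms(1) unfolding S_def \<zeta>_def by (intro primitive_root_cis) auto
    have "S \<subseteq> {..<n}"
    proof
      fix k assume k: "k \<in> S"
      \<comment> \<open>The index n is coprime to n only for n = 1; the n-th roots of unity are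
        enumerated by indices below n.\<close>
      then have "k \<noteq> n" using n False by (auto simp: S_def)
      with k show "k \<in> {..<n}" by (auto simp: S_def)
    qed
    then have inj: "inj_on \<zeta> S"
      using bij_betw_imp_inj_on[OF bij_betw_roots_unity[OF assms(1)]] unfolding \<zeta>_def by (rule inj_on_subset[rotated])
    have cyc: "(embed_q (cyclotomic n))\<^sup>2 = (\<Prod>k\<in>S. embed_q [:- \<zeta> k, 1:] ^ 2)"
      by (simp add: cyclotomic_def S_def \<zeta>_def embed_q_prod prod_power_distrib)
    have C1: "fract_cong ?L ?R ((embed_q (cyclotomic n))\<^sup>2)"
      unfolding cyc
    proof (rule fract_cong_prod_modulus)
      show "fract_cong ?L ?R (embed_q [:- \<zeta> k, 1:] ^ 2)" if "k \<in> S" for k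
        using A3[OF root[OF that]] False by simp
      show "coprime (embed_q [:- \<zeta> i, 1:] ^ 2) (embed_q [:- \<zeta> j, 1:] ^ 2)" if "i \<in> S" "j \<in> S" "i \<noteq> j" for i j
      proof -
        have "\<zeta> i \<noteq> \<zeta> j" using that inj by (auto dest: inj_onD)
        then have "coprime (embed_q [:- \<zeta> i, 1:]) (embed_q [:- \<zeta> j, 1:])"
          using point.coprime_at[OF point_peval[of "\<zeta> i" 0 0 0] prime_elem_embed_q_linear[of "\<zeta> i"]] by simp
        then show ?thesis by simp
      qed
    qed (simp add: S_def)
    \<comment> \<open>At q = \<zeta> and a = 2 the remaining factors take the values 1 and -1, hence
      are coprime to each q - \<zeta>.\<close>
    have cop: "coprime ((embed_q (cyclotomic n))\<^sup>2) P"
      if P: "\<And>z. z ^ n = 1 \<Longrightarrow> peval z 2 2 2 P \<noteq> 0" for P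
      unfolding cyc
    proof (rule prod_coprime_left)
      fix k assume "k \<in> S"
      then have "\<zeta> k ^ n = 1" using root by (auto simp: primitive_root_def)
      then have "coprime (embed_q [:- \<zeta> k, 1:]) P"
        using point.coprime_at[OF point_peval[of "\<zeta> k" 2 2 2] prime_elem_embed_q_linear[of "\<zeta> k"]] P by simp
      then show "coprime (embed_q [:- \<zeta> k, 1:] ^ 2) P" by simp
    qed
    have C2: "coprime (var_a - var_q ^ n) (1 - var_a * var_q ^ n)"
    proof (rule point.coprime_at[OF point_peval[of 2 "2 ^ n" 0 0] prime_elem_a_minus_power])
      have "(2::complex) ^ (n + n) \<noteq> 1" by (rule two) (use assms(1) in simp)
      then show "peval 2 (2 ^ n) 0 0 (1 - var_a * var_q ^ n) \<noteq> 0" by (simp add: power_add)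
    qed simp
    have "coprime ((embed_q (cyclotomic n))\<^sup>2 * (var_a - var_q ^ n)) (1 - var_a * var_q ^ n)"
      using cop[of "1 - var_a * var_q ^ n"] C2 by simp
    moreover have "coprime ((embed_q (cyclotomic n))\<^sup>2) (var_a - var_q ^ n)"
      by (rule cop) simp
    ultimately show ?thesis
      by (intro fract_cong_mult_modulus C1 A1 A2)
  qed
qed

end
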